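(* Let $G$ be the hexagonal lattice with parameter $m$, and let $N=N(m)$ be its number of vertices. Then \[ \lim_{N\to\infty}\frac{\sup_{p\in(0,1)}\mathbb{E}[C_p]}{N}\in(0.16738,\,0.17144), \] where the limit is taken along $N=N(m)$, $m\to\infty$.
   Context: The hexagonal lattice with parameter $m\ge1$ is the following finite piece of the infinite hexagonal (honeycomb) lattice: take the regular hexagons of side length $1$ with two horizontal sides, centred at the points $\left(\tfrac{3}{2}j,\ \sqrt{3}\,\bigl(i+\tfrac{1}{2}(j \bmod 2)\bigr)\right)$ for $0\le j\le m-1$, where $0\le i\le m-1$ if $j$ is even and $0\le i\le m-2$ if $j$ is odd (so there are $m$ columns of hexagons, alternately with $m$ and $m-1$ hexagons). The vertices of the graph are the corners of these hexagons and the edges are their sides. For a graph $G$ and $p\in[0,1]$, each vertex of $G$ is declared open with probability $p$ and closed with probability $1-p$, independently of the other vertices; $G_p$ is the subgraph of $G$ induced by the open vertices, and $C_p$ is the number of connected components of $G_p$. *)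

theory Defs
  imports "HOL-Probability.Probability"
begin

section \<open>The hexagonal lattice\<close>

text \<open>The plane is \<^typ>\<open>complex\<close>.\<close>

definition hex_centre :: "nat \<Rightarrow> nat \<Rightarrow> complex" where
  "hex_centre j i = Complex (3 / 2 * real j) (sqrt 3 * (real i + 1 / 2 * real (j mod 2)))"

text \<open>In column \<open>j\<close> the row index \<open>i\<close> ranges over \<open>0, \<dots>, m - 1\<close> for even \<open>j\<close> and over
  \<open>0, \<dots>, m - 2\<close> for odd \<open>j\<close>; an odd column only occurs for \<open>m \<ge> 2\<close>, so the truncated
  subtraction is harmless.\<close>

definition hex_centres :: "nat \<Rightarrow> complex set" where
  "hex_centres m = {hex_centre j i | j i. j < m \<and> i < (if even j then m else m - 1)}"

text \<open>A regular hexagon of side length 1 has circumradius 1; it has two horizontal sides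
  when its corners lie at the angles \<open>k \<pi> / 3\<close>.\<close>

definition hex_corner :: "complex \<Rightarrow> nat \<Rightarrow> complex" where
  "hex_corner c k = c + cis (real k * pi / 3)"

definition hex_verts :: "nat \<Rightarrow> complex set" where
  "hex_verts m = {hex_corner c k | c k. c \<in> hex_centres m \<and> k < 6}"

definition hex_edges :: "nat \<Rightarrow> complex set set" where
  "hex_edges m = {{hex_corner c k, hex_corner c (Suc k)} | c k. c \<in> hex_centres m \<and> k < 6}"

section \<open>Connected components and site percolation\<close>

text \<open>A graph is given by its vertex set \<open>V\<close> and its set \<open>E\<close> of two-element edges
  (contained in \<open>V\<close>).\<close>

definition components :: "'a set \<Rightarrow> 'a set set \<Rightarrow> 'a set set" where
  "components V E = V // {(u, v) \<in> V \<times> V. (u, v) \<in> {(x, y). {x, y} \<in> E}\<^sup>*}"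

definition induced_edges :: "'a set set \<Rightarrow> 'a set \<Rightarrow> 'a set set" where
  "induced_edges E U = {e \<in> E. e \<subseteq> U}"

text \<open>A configuration \<open>\<omega>\<close> maps each vertex of \<open>V\<close> to whether it is open. Under \<^const>\<open>Pi_pmf\<close>
  (which requires \<open>V\<close> to be finite) the values \<open>\<omega> v\<close>, \<open>v \<in> V\<close>, are independent; outside
  \<open>V\<close> the configuration is constantly \<^const>\<open>False\<close>.\<close>

definition site_percolation :: "'a set \<Rightarrow> real \<Rightarrow> ('a \<Rightarrow> bool) pmf" where
  "site_percolation V p = Pi_pmf V False (\<lambda>_. bernoulli_pmf p)"

definition open_verts :: "'a set \<Rightarrow> ('a \<Rightarrow> bool) \<Rightarrow> 'a set" where
  "open_verts V \<omega> = {v \<in> V. \<omega> v}"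

definition num_open_components :: "'a set \<Rightarrow> 'a set set \<Rightarrow> ('a \<Rightarrow> bool) \<Rightarrow> nat" where
  "num_open_components V E \<omega> =
     card (components (open_verts V \<omega>) (induced_edges E (open_verts V \<omega>)))"

definition expected_components :: "'a set \<Rightarrow> 'a set set \<Rightarrow> real \<Rightarrow> real" where
  "expected_components V E p =
     measure_pmf.expectation (site_percolation V p) (\<lambda>\<omega>. real (num_open_components V E \<omega>))"

end

theory Submission
  imports Defs "HOL-Real_Asymp.Real_Asymp"
begin

text \<open>Write the number of clusters as \<open>|V| - |E| + r\<close>, where \<open>r\<close> is the cycle rank of the open
  subgraph. Since there are asymptotically 3/2 edges per vertex, the first two terms contribute
  \<open>p - 3/2 p\<^sup>2\<close> per vertex, and it suffices to bound \<open>r\<close>.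

  For the upper bound, the lowest of the leftmost vertices of any subgraph of minimum degree two
  is surrounded by a configuration of probability \<open>p\<^sup>5 (2 - p)\<close>; deleting one edge at each such
  vertex leaves a forest. For the lower bound, the top edges of the open hexagons, and of the open
  12-cycles around a closed vertex, can all be deleted without disconnecting anything.

  The limit exists because large lattices are tiled by translates of small ones, and deleting the
  edges between the tiles can only increase the number of clusters.\<close>

section \<open>Connected components\<close>

text \<open>The target interval is only about 0.004 wide, yet one local pattern per even vertex,
  that is, per two vertices, is enough on each side. Per vertex, the upper bound adds
  \<open>p^5 (2 - p) / 2\<close> to \<open>p - 3/2 p^2\<close>, and the lower bound adds
  \<open>(p^6 + p^12 (1 - p)) / 2\<close>. The upper one stays below 0.1714 on the whole unit
  interval. The lower one is used only at p = 0.338, close to its maximum, where it exceeds 0.16738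
  by less than 3 * 10^-7. Convergence for each fixed p would not control the supremum. The tiling
  inequality therefore has an error that does not depend on p, so it passes to the supremum over p
  and yields a Fekete-type argument for the suprema themselves.\<close>

abbreviation reach :: "'a set set \<Rightarrow> ('a \<times> 'a) set" where
  "reach E \<equiv> {(x, y). {x, y} \<in> E}\<^sup>*"

definition component_of :: "'a set set \<Rightarrow> 'a \<Rightarrow> 'a set" where
  "component_of E v = reach E `` {v}"

lemma reach_sym: "(x, y) \<in> reach E \<Longrightarrow> (y, x) \<in> reach E"
proof -
  have "sym {(x, y). {x, y} \<in> E}" by (auto simp: sym_def insert_commute)
  then show "(x, y) \<in> reach E \<Longrightarrow> (y, x) \<in> reach E"
    using sym_rtrancl by (metis symD)
qed

lemma reach_edge: "{x, y} \<in> E \<Longrightarrow> (x, y) \<in> reach E"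
  by auto

lemma reach_mono: "E \<subseteq> F \<Longrightarrow> reach E \<subseteq> reach F"
  by (intro rtrancl_mono) auto

lemma reach_least:
  assumes "\<And>x y. {x, y} \<in> E \<Longrightarrow> (x, y) \<in> reach F"
  shows "reach E \<subseteq> reach F"
proof -
  have "{(x, y). {x, y} \<in> E} \<subseteq> reach F" using assms by auto
  then show ?thesis by (metis rtrancl_mono rtrancl_idemp)
qed

lemma component_of_refl: "v \<in> component_of E v"
  by (simp add: component_of_def)

lemma component_of_eq: "(u, v) \<in> reach E \<Longrightarrow> component_of E u = component_of E v"
  unfolding component_of_def by (auto intro: rtrancl_trans reach_sym)

lemma component_of_eq_iff: "component_of E u = component_of E v \<longleftrightarrow> (u, v) \<in> reach E"
proof
  assume "component_of E u = component_of E v"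
  then have "v \<in> component_of E u" using component_of_refl by metis
  then show "(u, v) \<in> reach E" by (simp add: component_of_def)
qed (rule component_of_eq)

lemma reach_in:
  assumes "(u, v) \<in> reach E" "\<Union>E \<subseteq> V" "u \<in> V"
  shows "v \<in> V"
  using assms by (induction rule: rtrancl_induct) auto

text \<open>A path that starts in \<open>V\<close> stays in \<open>V\<close> when all edges do.
  Components thus become images of vertices under \<open>component_of\<close>, a form in which
  different edge sets are easy to compare.\<close>

lemma components_eq_image:
  assumes "\<Union>E \<subseteq> V"
  shows "components V E = component_of E ` V"
proof -
  have "{(u, v) \<in> V \<times> V. (u, v) \<in> reach E} `` {v} = component_of E v" if "v \<in> V" for v
    using that reach_in[OF _ assms that] unfolding component_of_def by auto
  then show ?thesis unfolding components_def quotient_def by auto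
qed

text \<open>Closing a set under the larger reachability maps the components for \<open>E\<close>
  onto those for \<open>F\<close>.\<close>

lemma card_component_image_mono:
  assumes "finite V" "reach E \<subseteq> reach F"
  shows "card (component_of F ` V) \<le> card (component_of E ` V)"
proof (rule surj_card_le[where f = "\<lambda>X. reach F `` X"])
  have "component_of F v = reach F `` component_of E v" for v
    using assms(2) unfolding component_of_def by (auto intro: rtrancl_trans)
  then show "component_of F ` V \<subseteq> (\<lambda>X. reach F `` X) ` component_of E ` V" by auto
qed (use assms in auto)

lemma card_components_le_card:
  assumes "finite V" "\<Union>E \<subseteq> V"
  shows "card (components V E) \<le> card V"
  using assms by (simp add: components_eq_image card_image_le)

lemma card_components_antimono:
  assumes "finite V" "\<Union>F \<subseteq> V" "E \<subseteq> F"
  shows "card (components V F) \<le> card (components V E)"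
proof -
  have "\<Union>E \<subseteq> V" using assms by auto
  then show ?thesis
    using assms card_component_image_mono[OF _ reach_mono] by (simp add: components_eq_image)
qed

lemma card_components_eq:
  assumes "finite V" "\<Union>F \<subseteq> V" "E \<subseteq> F" "\<And>x y. {x, y} \<in> F \<Longrightarrow> (x, y) \<in> reach E"
  shows "card (components V F) = card (components V E)"
proof -
  have "\<Union>E \<subseteq> V" using assms by auto
  then have "card (components V E) \<le> card (components V F)"
    using card_component_image_mono[OF assms(1) reach_least[OF assms(4)]] assms(2)
    by (simp add: components_eq_image)
  then show ?thesis using card_components_antimono[OF assms(1-3)] by simp
qed

text \<open>The source of subadditivity: edges between \<open>V\<close> and \<open>W\<close> are
  dropped, and a component of the union is charged to a part that it meets.\<close>

lemma card_components_Un: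
  assumes "finite V" "finite W" "\<Union>E \<subseteq> V \<union> W" "E1 \<subseteq> E" "E2 \<subseteq> E" "\<Union>E1 \<subseteq> V" "\<Union>E2 \<subseteq> W"
  shows "card (components (V \<union> W) E) \<le> card (components V E1) + card (components W E2)"
proof -
  have "card (component_of E ` V) \<le> card (component_of E1 ` V)"
    "card (component_of E ` W) \<le> card (component_of E2 ` W)"
    using assms by (auto intro!: card_component_image_mono reach_mono)
  then show ?thesis
    using assms card_Un_le[of "component_of E ` V" "component_of E ` W"]
    by (simp add: components_eq_image image_Un)
qed

section \<open>Component counts against edge counts\<close>

lemma reach_insert:
  assumes "(u, v) \<in> reach (insert {x, y} E)"
    and "(u, x) \<notin> reach E" "(u, y) \<notin> reach E"
  shows "(u, v) \<in> reach E"
  using assms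
proof (induction rule: rtrancl_induct)
  case (step v w)
  then have *: "(u, v) \<in> reach E" by simp
  from step(2) consider "{v, w} \<in> E" | "v = x" | "v = y" by (auto simp: doubleton_eq_iff)
  then show ?case
  proof cases
    case 1
    then show ?thesis using * by (auto intro: rtrancl_into_rtrancl)
  qed (use * step in auto)
qed simp

text \<open>A new edge can only merge the classes \<open>?X\<close> and \<open>?Y\<close> of its
  ends. Every other class survives unchanged and differs from the merged class \<open>?Z\<close>, so
  at most one class is lost.\<close>

lemma card_components_insert:
  assumes "finite V" "\<Union>E \<subseteq> V" "x \<in> V" "y \<in> V"
  shows "card (components V E) \<le> card (components V (insert {x, y} E)) + 1"
proof -
  let ?F = "insert {x, y} E"
  let ?X = "component_of E x" and ?Y = "component_of E y" and ?Z = "component_of ?F x"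
  have "A \<in> component_of ?F ` V - {?Z}" if A: "A \<in> component_of E ` V - {?X, ?Y}" for A
  proof -
    obtain u where u: "u \<in> V" "A = component_of E u" using A by auto
    then have n: "(u, x) \<notin> reach E" "(u, y) \<notin> reach E"
      using A by (auto simp: component_of_eq_iff)
    then have "component_of ?F u = component_of E u"
      using reach_insert[of u _ x y E] reach_mono[of E ?F]
      unfolding component_of_def by auto
    moreover have "component_of ?F u \<noteq> ?Z"
      using n reach_insert[of u x x y E] by (auto simp: component_of_eq_iff)
    ultimately show ?thesis using u by auto
  qed
  then have sub: "component_of E ` V - {?X, ?Y} \<subseteq> component_of ?F ` V - {?Z}" by blast
  have "card (component_of E ` V) - card {?X, ?Y} \<le> card (component_of E ` V - {?X, ?Y})"
    by (rule diff_card_le_card_Diff) simp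
  also have "\<dots> \<le> card (component_of ?F ` V - {?Z})"
    by (rule card_mono[OF _ sub]) (simp add: assms)
  also have "\<dots> = card (component_of ?F ` V) - 1"
    using assms by (simp add: card_Diff_singleton)
  finally have "card (component_of E ` V) - card {?X, ?Y} \<le> card (component_of ?F ` V) - 1" .
  moreover have "card {?X, ?Y} \<le> 2" by (simp add: card_insert_if)
  moreover have "card (component_of ?F ` V) > 0" using assms by (auto simp: card_gt_0_iff)
  moreover have "\<Union>?F \<subseteq> V" using assms by auto
  ultimately show ?thesis using assms by (simp add: components_eq_image)
qed

lemma card_le_components_plus_edges:
  assumes "finite E" "finite V" "\<Union>E \<subseteq> V" "\<And>e. e \<in> E \<Longrightarrow> card e = 2"
  shows "card V \<le> card (components V E) + card E"
  using assms(1,3,4)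
proof (induction E rule: finite_induct)
  case empty
  have "component_of {} v = {v}" for v :: 'a by (auto simp: component_of_def)
  then show ?case by (simp add: components_eq_image card_image)
next
  case (insert e E)
  from insert.prems(2)[of e] obtain x y where e: "e = {x, y}" by (auto simp: card_2_iff)
  then have "card (components V E) \<le> card (components V (insert e E)) + 1"
    using insert.prems(1) assms(2) by (intro card_components_insert[of V E x y, folded e]) auto
  then show ?case using insert by auto
qed

text \<open>The last hypothesis expresses acyclicity without mentioning cycles: every nonempty set
  of vertices contains one of induced degree at most one. Removing such a vertex of \<open>V\<close>
  deletes at most one edge, and it can cost a component only if it deletes none.\<close>

lemma forest_components_plus_edges_le:
  assumes "finite V" "\<Union>E \<subseteq> V" "\<And>e. e \<in> E \<Longrightarrow> card e = 2"
    and "\<And>W. W \<subseteq> V \<Longrightarrow> W \<noteq> {} \<Longrightarrow> \<exists>v\<in>W. card {e \<in> E. v \<in> e \<and> e \<subseteq> W} \<le> 1"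
  shows "card (components V E) + card E \<le> card V"
  using assms
proof (induction "card V" arbitrary: V E rule: less_induct)
  case less
  show ?case
  proof (cases "V = {}")
    case True
    have "E = {}"
    proof (rule ccontr)
      assume "E \<noteq> {}"
      then obtain e where "e \<in> E" by auto
      then have "e = {}" "card e = 2" using less.prems True by auto
      then show False by simp
    qed
    then show ?thesis using True by (simp add: components_def)
  next
    case False
    have finE: "finite E" using less.prems(1,2) by (auto intro: finite_UnionD finite_subset)
    obtain v where v: "v \<in> V" "card {e \<in> E. v \<in> e \<and> e \<subseteq> V} \<le> 1"
      using less.prems(4)[of V] False by auto
    let ?S = "{e \<in> E. v \<in> e}"
    have S: "{e \<in> E. v \<in> e \<and> e \<subseteq> V} = ?S" using less.prems(2) by auto
    define V' where "V' = V - {v}"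
    define E' where "E' = {e \<in> E. v \<notin> e}"
    have cV: "card V = card V' + 1"
      unfolding V'_def using card_Suc_Diff1[OF less.prems(1) v(1)] by simp
    have V': "card V' < card V" "finite V'" "V = V' \<union> {v}" "card V = card V' + 1"
      using v less.prems(1) cV by (auto simp: V'_def)
    have E': "\<Union>E' \<subseteq> V'" "E' \<subseteq> E" using less.prems(2) by (auto simp: E'_def V'_def)
    have "E = E' \<union> ?S" "E' \<inter> ?S = {}" by (auto simp: E'_def)
    then have cE: "card E = card E' + card ?S"
      using finE by (metis card_Un_disjoint finite_Un)
    have IH: "card (components V' E') + card E' \<le> card V'"
    proof (rule less.hyps)
      fix W assume W: "W \<subseteq> V'" "W \<noteq> {}"
      then obtain u where u: "u \<in> W" "card {e \<in> E. u \<in> e \<and> e \<subseteq> W} \<le> 1"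
        using less.prems(4)[of W] V' by auto
      have "card {e \<in> E'. u \<in> e \<and> e \<subseteq> W} \<le> card {e \<in> E. u \<in> e \<and> e \<subseteq> W}"
        using finE by (intro card_mono) (auto simp: E'_def)
      then show "\<exists>u\<in>W. card {e \<in> E'. u \<in> e \<and> e \<subseteq> W} \<le> 1" using u by (intro bexI[of _ u]) auto
    qed (use V' E' less.prems in auto)
    show ?thesis
    proof (cases "?S = {}")
      case True
      have "card (components V E) \<le> card (components V' E') + card (components {v} {})"
        unfolding V'(3) by (rule card_components_Un)
          (use V'(2) E' less.prems(2) in \<open>auto simp: V'_def\<close>)
      also have "card (components {v} ({} :: 'a set set)) \<le> 1"
        using card_components_le_card[of "{v}" "{}"] by simp
      finally show ?thesis using IH cE True cV by simp
    next
      case False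
      then have "card ?S > 0" using finE by (simp add: card_gt_0_iff)
      then have S1: "card ?S = 1" using v(2) unfolding S by simp
      from False obtain e where e: "e \<in> E" "v \<in> e" by auto
      then obtain u where u: "e = {v, u}" "u \<noteq> v" using less.prems(3)[of e]
        by (auto simp: card_2_iff doubleton_eq_iff)
      then have uV: "u \<in> V'" using e less.prems(2) by (auto simp: V'_def)
      have "component_of E v = component_of E u" using u e by (intro component_of_eq reach_edge) simp
      then have "component_of E ` V = component_of E ` V'" using uV V'(3) by auto
      then have "card (components V E) \<le> card (components V' E')"
        using card_component_image_mono[OF V'(2) reach_mono[OF E'(2)]] E' less.prems(2)
        by (simp add: components_eq_image)
      then show ?thesis using IH cE S1 cV by simp
    qed
  qed
qed

text \<open>Serves both the translations of the brick wall and its embedding into the plane.\<close>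

lemma card_components_image:
  assumes "inj f"
  shows "card (components (f ` V) ((`) f ` E)) = card (components V E)"
proof -
  let ?R = "{(u, v) \<in> V \<times> V. (u, v) \<in> reach E}"
  let ?S = "{(u, v) \<in> f ` V \<times> f ` V. (u, v) \<in> reach ((`) f ` E)}"
  have edge: "{x, y} \<in> (`) f ` E \<longleftrightarrow> (\<exists>a b. x = f a \<and> y = f b \<and> {a, b} \<in> E)" for x y
  proof
    assume "{x, y} \<in> (`) f ` E"
    then obtain e where e: "e \<in> E" "f ` e = {x, y}" by auto
    then obtain a b where ab: "a \<in> e" "b \<in> e" "x = f a" "y = f b" by (metis insertCI imageE)
    have "e = {a, b}" using e ab assms by (metis image_insert image_empty inj_image_eq_iff)
    then show "\<exists>a b. x = f a \<and> y = f b \<and> {a, b} \<in> E" using e ab by auto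
  qed (auto intro: image_eqI[of _ _ "{_, _}"])
  have 1: "(f a, f b) \<in> reach ((`) f ` E)" if "(a, b) \<in> reach E" for a b
    using that
  proof (induction rule: rtrancl_induct)
    case (step b c)
    then have "{f b, f c} \<in> (`) f ` E" using edge by auto
    then show ?case using step by (auto intro: rtrancl_into_rtrancl)
  qed simp
  \<comment> \<open>Paths in the image lift: injectivity identifies the end of the lifted part with
    the start of the next lifted edge.\<close>
  have 2: "\<exists>b. y = f b \<and> (a, b) \<in> reach E" if "(f a, y) \<in> reach ((`) f ` E)" for a y
    using that
  proof (induction rule: rtrancl_induct)
    case (step y z)
    then obtain b where b: "y = f b" "(a, b) \<in> reach E" by auto
    from step(2) obtain b' c where "y = f b'" "z = f c" "{b', c} \<in> E" by (auto simp: edge)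
    then show ?case using b assms by (auto simp: inj_eq intro: rtrancl_into_rtrancl)
  qed auto
  have "?S `` {f v} = f ` (?R `` {v})" if "v \<in> V" for v
    using that 1 2 assms by (fastforce simp: inj_eq image_iff)
  then have "components (f ` V) ((`) f ` E) = (`) f ` components V E"
    unfolding components_def quotient_def by auto
  moreover have "inj_on ((`) f) (components V E)"
    using assms by (auto simp: inj_on_def inj_image_eq_iff)
  ultimately show ?thesis by (simp add: card_image)
qed

section \<open>The brick wall\<close>

text \<open>The honeycomb is isomorphic to a brick wall on the integer lattice. The vertical line \<open>c\<close>
  of the wall is the zigzag path between the columns \<open>c - 1\<close> and \<open>c\<close> of hexagons. A vertex
  \<open>(c, y)\<close> with \<open>c + y\<close> even is the left corner of a hexagon, whose corners are
  \<open>{c, c + 1} \<times> {y - 1, y, y + 1}\<close>.\<close>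

type_synonym vertex = "int \<times> int"

definition vert_edge :: "vertex \<Rightarrow> vertex set" where
  "vert_edge v = {v, (fst v, snd v + 1)}"

definition horiz_edge :: "vertex \<Rightarrow> vertex set" where
  "horiz_edge v = {v, (fst v + 1, snd v)}"

definition even_verts :: "vertex set" where
  "even_verts = {v. even (fst v + snd v)}"

text \<open>Each vertex has exactly one horizontal neighbour, to the right of an odd vertex and to
  the left of an even one; with the two vertical ones this makes the wall cubic.\<close>

definition brick_edges :: "vertex set set" where
  "brick_edges = range vert_edge \<union> horiz_edge ` (- even_verts)"

lemma brick_edge_cases:
  assumes "e \<in> brick_edges"
  obtains a b where "e = {(a, b), (a, b + 1)}" | a b where "e = {(a, b), (a + 1, b)}" "odd (a + b)"
proof -
  from assms consider v where "e = vert_edge v" | v where "e = horiz_edge v" "v \<notin> even_verts"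
    unfolding brick_edges_def by auto
  then show thesis
  proof cases
    case (1 v)
    then show thesis using that(1)[of "fst v" "snd v"] by (simp add: vert_edge_def)
  next
    case (2 v)
    then show thesis using that(2)[of "fst v" "snd v"] by (simp add: horiz_edge_def even_verts_def)
  qed
qed

lemma brick_edge_iff:
  "{(a, b), (c, d)} \<in> brick_edges \<longleftrightarrow>
     a = c \<and> (d = b + 1 \<or> b = d + 1) \<or>
     b = d \<and> (c = a + 1 \<and> odd (a + b) \<or> a = c + 1 \<and> odd (c + d))"
    (is "_ \<longleftrightarrow> ?R")
proof
  assume "{(a, b), (c, d)} \<in> brick_edges"
  then show ?R by (cases rule: brick_edge_cases) (auto simp: doubleton_eq_iff)
next
  have vert: "{(i, j), (i, j + 1)} \<in> brick_edges" for i j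
    unfolding brick_edges_def vert_edge_def by (intro UnI1 image_eqI[of _ _ "(i, j)"]) auto
  have horiz: "{(i, j), (i + 1, j)} \<in> brick_edges" if "odd (i + j)" for i j
    unfolding brick_edges_def horiz_edge_def even_verts_def
    using that by (intro UnI2 image_eqI[of _ _ "(i, j)"]) auto
  assume ?R
  then show "{(a, b), (c, d)} \<in> brick_edges"
    using vert[of a b] vert[of c d] horiz[of a b] horiz[of c d]
    by (elim disjE conjE) (simp_all add: insert_commute)
qed

lemma card_brick_edge: "e \<in> brick_edges \<Longrightarrow> card e = 2"
  by (erule brick_edge_cases) auto

lemma brick_edges_at:
  assumes "e \<in> brick_edges" "(a, b) \<in> e"
  shows "e \<in> {{(a, b), (a, b + 1)}, {(a, b), (a, b - 1)},
    {(a, b), (if even (a + b) then a - 1 else a + 1, b)}}"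
  using assms(1)
proof (cases rule: brick_edge_cases)
  case (1 c d)
  then consider "c = a" "d = b" | "c = a" "d = b - 1" using assms(2) by fastforce
  then show ?thesis by cases (simp_all add: 1 insert_commute)
next
  case (2 c d)
  then consider "c = a" "d = b" | "c = a - 1" "d = b" using assms(2) by fastforce
  then show ?thesis by cases (use 2 in \<open>simp_all add: insert_commute\<close>)
qed

abbreviation brick :: "vertex set \<Rightarrow> vertex set set" where
  "brick U \<equiv> induced_edges brick_edges U"

definition clusters :: "vertex set \<Rightarrow> nat" where
  "clusters U = card (components U (brick U))"

lemma Union_brick: "\<Union>(brick U) \<subseteq> U"
  by (auto simp: induced_edges_def)

lemma finite_brick: "finite U \<Longrightarrow> finite (brick U)"
  by (rule finite_subset[of _ "Pow U"]) (auto simp: induced_edges_def)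

lemma clusters_le_card: "finite U \<Longrightarrow> clusters U \<le> card U"
  unfolding clusters_def by (rule card_components_le_card[OF _ Union_brick])

lemma clusters_Un:
  assumes "finite U" "finite W"
  shows "clusters (U \<union> W) \<le> clusters U + clusters W"
  unfolding clusters_def using assms Union_brick
  by (intro card_components_Un) (auto simp: induced_edges_def)

section \<open>Upper bound for the number of clusters\<close>

text \<open>In a subgraph of minimum degree two, the lowest of the leftmost vertices is a hook.\<close>

definition hook :: "vertex \<Rightarrow> vertex set \<Rightarrow> bool" where
  "hook v U = (case v of (c, y) \<Rightarrow> {(c, y), (c, y - 1), (c, y + 1), (c + 1, y - 1)} \<subseteq> U \<and>
     ((c + 1, y + 1) \<in> U \<or> (c, y + 2) \<in> U))"

lemma hook_mono: "hook v U \<Longrightarrow> U \<subseteq> W \<Longrightarrow> hook v W"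
  by (auto simp: hook_def split: prod.splits)

lemma two_of_three:
  assumes "e \<in> {A, B, C}" "f \<in> {A, B, C}" "e \<noteq> f" "e \<in> S" "f \<in> S"
  shows "{A, B} \<subseteq> S \<or> {A, C} \<subseteq> S \<or> {B, C} \<subseteq> S"
  using assms by auto

text \<open>If every degree were at least two, consider the lowest even vertex of the leftmost line.
  Having no left neighbour, it uses both vertical edges; by minimality the vertex below it must turn
  right, and the vertex above it continues up or to the right. This is a hook whose lower edge is
  present, contrary to the assumption.\<close>

lemma unhooked_subset_has_leaf:
  assumes W: "finite W" "W \<noteq> {}" and E: "E \<subseteq> brick_edges"
    and hook: "\<And>c y. even (c + y) \<Longrightarrow> hook (c, y) W \<Longrightarrow> {(c, y), (c, y - 1)} \<notin> E"
  shows "\<exists>v\<in>W. card {e \<in> E. v \<in> e \<and> e \<subseteq> W} \<le> 1"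
proof (rule ccontr)
  assume neg: "\<not> ?thesis"
  have two: "\<exists>e f. e \<noteq> f \<and> e \<in> E \<and> f \<in> E \<and> v \<in> e \<and> v \<in> f \<and> e \<subseteq> W \<and> f \<subseteq> W" if "v \<in> W" for v
  proof -
    have "\<not> card {e \<in> E. v \<in> e \<and> e \<subseteq> W} \<le> Suc 0" using neg that by auto
    moreover have "finite {e \<in> E. v \<in> e \<and> e \<subseteq> W}"
      by (rule finite_subset[of _ "Pow W"]) (use W in auto)
    ultimately show ?thesis by (simp add: card_le_Suc0_iff_eq) blast
  qed
  have nb: "{{(a, b), (a, b + 1)}, {(a, b), (a, b - 1)}} \<subseteq> {e \<in> E. e \<subseteq> W} \<or>
      {{(a, b), (a, b + 1)}, {(a, b), (a', b)}} \<subseteq> {e \<in> E. e \<subseteq> W} \<or>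
      {{(a, b), (a, b - 1)}, {(a, b), (a', b)}} \<subseteq> {e \<in> E. e \<subseteq> W}"
    if ab: "(a, b) \<in> W" and a': "a' = (if even (a + b) then a - 1 else a + 1)" for a b a'
  proof -
    obtain e f where ef: "e \<noteq> f" "e \<in> E" "f \<in> E" "(a, b) \<in> e" "(a, b) \<in> f" "e \<subseteq> W" "f \<subseteq> W"
      using two[OF ab] by blast
    have "e \<in> {{(a, b), (a, b + 1)}, {(a, b), (a, b - 1)}, {(a, b), (a', b)}}"
      "f \<in> {{(a, b), (a, b + 1)}, {(a, b), (a, b - 1)}, {(a, b), (a', b)}}"
      unfolding a' using ef E by (intro brick_edges_at; auto)+
    then show ?thesis by (rule two_of_three) (use ef in simp_all)
  qed
  define c where "c = Min (fst ` W)"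
  have left: "c \<le> a" if "(a, b) \<in> W" for a b
    unfolding c_def by (rule Min_le[OF finite_imageI[OF W(1)] rev_image_eqI[OF that]]) simp
  have "c \<in> fst ` W" unfolding c_def using W by (intro Min_in) auto
  then obtain b where b: "(c, b) \<in> W" by auto
  let ?Y = "{y. (c, y) \<in> W \<and> even (c + y)}"
  have finY: "finite ?Y" by (rule finite_subset[of _ "snd ` W"]) (use W in force)+
  \<comment> \<open>An odd vertex has only one horizontal edge, so degree two forces a vertical
    neighbour, which is even.\<close>
  have "?Y \<noteq> {}"
  proof (cases "even (c + b)")
    case False
    then have "(c, b + 1) \<in> W \<or> (c, b - 1) \<in> W" using nb[OF b refl] by auto
    then show ?thesis using False by (auto intro: exI[of _ "b + 1"] exI[of _ "b - 1"])
  qed (use b in auto)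
  define y where "y = Min ?Y"
  have "y \<in> ?Y" unfolding y_def using finY \<open>?Y \<noteq> {}\<close> by (rule Min_in)
  then have y: "(c, y) \<in> W" "even (c + y)" by auto
  have low: "(c, y - 2) \<notin> W"
  proof
    assume "(c, y - 2) \<in> W"
    then have "y - 2 \<in> ?Y" using y by auto
    then have "y \<le> y - 2" unfolding y_def using finY by (intro Min_le)
    then show False by simp
  qed
  have "(c - 1, y) \<notin> W" using left by force
  then have 1: "(c, y + 1) \<in> W" "(c, y - 1) \<in> W" "{(c, y), (c, y - 1)} \<in> E"
    using nb[OF y(1) refl] y(2) by auto
  have "(c + 1, y - 1) \<in> W" using nb[OF 1(2) refl] y(2) low by auto
  moreover have "(c + 1, y + 1) \<in> W \<or> (c, y + 2) \<in> W"
    using nb[OF 1(1) refl] y(2) by (auto simp: algebra_simps)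
  ultimately have "hook (c, y) W" using 1 y by (simp add: hook_def)
  then show False using hook[OF y(2)] 1(3) by blast
qed

lemma clusters_plus_edges_le:
  assumes "finite U"
  shows "clusters U + card (brick U) \<le> card U + card {v \<in> U \<inter> even_verts. hook v U}"
proof -
  let ?H = "{v \<in> U \<inter> even_verts. hook v U}"
  define R where "R = (\<lambda>v. {v, (fst v, snd v - 1)}) ` ?H"
  define E where "E = brick U - R"
  have cR: "card R \<le> card ?H" unfolding R_def using assms by (intro card_image_le) simp
  have fin: "finite R" "finite (brick U)" unfolding R_def using assms finite_brick by auto
  have "card (components U E) + card E \<le> card U"
  proof (rule forest_components_plus_edges_le[OF assms])
    fix W assume W: "W \<subseteq> U" "W \<noteq> {}"
    show "\<exists>v\<in>W. card {e \<in> E. v \<in> e \<and> e \<subseteq> W} \<le> 1"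
    proof (rule unhooked_subset_has_leaf)
      fix c y assume "even (c + y)" "hook (c, y) W"
      \<comment> \<open>Hooks are monotone, so one deletion made with respect to \<open>U\<close>
        serves every subset \<open>W\<close> at once.\<close>
      then have "(c, y) \<in> ?H" using W hook_mono[of "(c, y)" W U]
        by (auto simp: even_verts_def hook_def)
      then show "{(c, y), (c, y - 1)} \<notin> E" unfolding E_def R_def by force
    qed (use W assms in \<open>auto simp: E_def induced_edges_def intro: finite_subset\<close>)
  qed (auto simp: E_def induced_edges_def card_brick_edge)
  moreover have "clusters U \<le> card (components U E)"
    unfolding clusters_def using assms Union_brick
    by (intro card_components_antimono) (auto simp: E_def)
  moreover have "card (brick U) \<le> card E + card R"
    using card_mono[of "E \<union> R" "brick U"] card_Un_le[of E R] fin by (auto simp: E_def)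
  ultimately show ?thesis using cR by linarith
qed

section \<open>Lower bound for the number of clusters\<close>

text \<open>The open ring around the closed vertex \<open>(c + 1, y - 1)\<close> is the boundary of the union of the
  three hexagons at that vertex.\<close>

definition hexagon :: "vertex \<Rightarrow> vertex set" where
  "hexagon v = (case v of (c, y) \<Rightarrow> {c, c + 1} \<times> {y - 1, y, y + 1})"

definition ring_centre :: "vertex \<Rightarrow> vertex" where
  "ring_centre v = (fst v + 1, snd v - 1)"

definition ring :: "vertex \<Rightarrow> vertex set" where
  "ring v = (case v of (c, y) \<Rightarrow> {c} \<times> {y - 3, y - 2, y - 1, y, y + 1} \<union>
     {c + 1} \<times> {y - 3, y - 2, y, y + 1} \<union> {c + 2} \<times> {y - 2, y - 1, y})"

text \<open>The two cycles share their top edge, and the ring centre is a corner of the hexagon. The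
  alternatives therefore exclude each other, and their probabilities add without any edge being
  counted twice.\<close>

definition cyclic :: "vertex \<Rightarrow> vertex set \<Rightarrow> bool" where
  "cyclic v U \<longleftrightarrow> hexagon v \<subseteq> U \<or> ring v \<subseteq> U \<and> ring_centre v \<notin> U"

definition top_edge :: "vertex \<Rightarrow> vertex set" where
  "top_edge v = {(fst v, snd v + 1), (fst v + 1, snd v + 1)}"

text \<open>The deleted edge is the unique highest horizontal edge of its cycle. The detour along
  the rest of the cycle uses vertical edges, which are never deleted, and strictly lower horizontal
  ones, which may be deleted too but are covered by induction on the height above
  \<open>lo\<close>.\<close>

lemma reach_without_top_edges:
  fixes lo :: int
  assumes lo: "\<And>a b. (a, b) \<in> U \<Longrightarrow> lo \<le> b"
    and E: "E = brick U - top_edge ` {v \<in> even_verts. cyclic v U}"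
    and "(a, b) \<in> U" "(a + 1, b) \<in> U" "odd (a + b)"
  shows "((a, b), (a + 1, b)) \<in> reach E"
  using assms(3-5)
proof (induction "nat (b - lo)" arbitrary: a b rule: less_induct)
  case less
  have vert: "((c, d), (c, d + 1)) \<in> reach E" if "(c, d) \<in> U" "(c, d + 1) \<in> U" for c d
  proof -
    have "{(c, d), (c, d + 1)} \<in> E" using that unfolding E induced_edges_def top_edge_def
      by (auto simp: brick_edge_iff doubleton_eq_iff)
    then show ?thesis by (rule reach_edge)
  qed
  note vert' = vert[THEN reach_sym]
  have horiz: "((c, d), (c + 1, d)) \<in> reach E"
    if "(c, d) \<in> U" "(c + 1, d) \<in> U" "odd (c + d)" "d < b" for c d
    using that lo[of c d] by (intro less.hyps) auto
  note horiz' = horiz[THEN reach_sym]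
  have "{(a, b), (a + 1, b)} \<in> brick U"
    using less.prems by (auto simp: induced_edges_def brick_edge_iff)
  then consider "{(a, b), (a + 1, b)} \<in> E" | v where "v \<in> even_verts" "cyclic v U"
    "{(a, b), (a + 1, b)} = top_edge v" unfolding E by blast
  then show ?case
  proof cases
    case (2 v)
    then have v: "v = (a, b - 1)" by (auto simp: top_edge_def doubleton_eq_iff prod_eq_iff)
    from 2(2) consider "hexagon v \<subseteq> U" | "ring v \<subseteq> U" unfolding cyclic_def by blast
    then show ?thesis
    proof cases
      case 1
      then have U: "(a, b - 1) \<in> U" "(a, b - 2) \<in> U" "(a + 1, b - 1) \<in> U" "(a + 1, b - 2) \<in> U"
        by (auto simp: hexagon_def v)
      have "((a, b), (a, b - 1)) \<in> reach E" using vert'[of a "b - 1"] U less.prems by simp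
      also have "((a, b - 1), (a, b - 2)) \<in> reach E"
        using vert'[of a "b - 2"] U by simp
      also (rtrancl_trans) have "((a, b - 2), (a + 1, b - 2)) \<in> reach E"
        using horiz[of a "b - 2"] U less.prems by simp
      also (rtrancl_trans) have "((a + 1, b - 2), (a + 1, b - 1)) \<in> reach E"
        using vert[of "a + 1" "b - 2"] U by simp
      also (rtrancl_trans) have "((a + 1, b - 1), (a + 1, b)) \<in> reach E"
        using vert[of "a + 1" "b - 1"] U less.prems by simp
      finally (rtrancl_trans) show ?thesis .
    next
      case 2
      then have U: "(a, b - 1) \<in> U" "(a, b - 2) \<in> U" "(a, b - 3) \<in> U" "(a, b - 4) \<in> U"
        "(a + 1, b - 4) \<in> U" "(a + 1, b - 3) \<in> U" "(a + 2, b - 3) \<in> U" "(a + 2, b - 2) \<in> U"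
        "(a + 2, b - 1) \<in> U" "(a + 1, b - 1) \<in> U"
        by (auto simp: ring_def v)
      have "((a, b), (a, b - 1)) \<in> reach E" using vert'[of a "b - 1"] U less.prems by simp
      also have "((a, b - 1), (a, b - 2)) \<in> reach E"
        using vert'[of a "b - 2"] U by simp
      also (rtrancl_trans) have "((a, b - 2), (a, b - 3)) \<in> reach E"
        using vert'[of a "b - 3"] U by simp
      also (rtrancl_trans) have "((a, b - 3), (a, b - 4)) \<in> reach E"
        using vert'[of a "b - 4"] U by simp
      also (rtrancl_trans) have "((a, b - 4), (a + 1, b - 4)) \<in> reach E"
        using horiz[of a "b - 4"] U less.prems by simp
      also (rtrancl_trans) have "((a + 1, b - 4), (a + 1, b - 3)) \<in> reach E"
        using vert[of "a + 1" "b - 4"] U by simp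
      also (rtrancl_trans) have "((a + 1, b - 3), (a + 2, b - 3)) \<in> reach E"
        using horiz[of "a + 1" "b - 3"] U less.prems by (simp add: add.assoc)
      also (rtrancl_trans) have "((a + 2, b - 3), (a + 2, b - 2)) \<in> reach E"
        using vert[of "a + 2" "b - 3"] U by simp
      also (rtrancl_trans) have "((a + 2, b - 2), (a + 2, b - 1)) \<in> reach E"
        using vert[of "a + 2" "b - 2"] U by simp
      also (rtrancl_trans) have "((a + 2, b - 1), (a + 1, b - 1)) \<in> reach E"
        using horiz'[of "a + 1" "b - 1"] U less.prems by (simp add: add.assoc)
      also (rtrancl_trans) have "((a + 1, b - 1), (a + 1, b)) \<in> reach E"
        using vert[of "a + 1" "b - 1"] U less.prems by simp
      finally (rtrancl_trans) show ?thesis .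
    qed
  qed (rule reach_edge)
qed

text \<open>Deleting the top edges leaves the components unchanged, and in any graph components plus
  edges are at least as many as vertices.\<close>

lemma card_plus_cyclic_le:
  assumes "finite U"
  shows "card U + card {v \<in> even_verts. cyclic v U} \<le> clusters U + card (brick U)"
proof -
  let ?C = "{v \<in> even_verts. cyclic v U}"
  define E where "E = brick U - top_edge ` ?C"
  have top: "top_edge ` ?C \<subseteq> brick U"
    by (auto simp: cyclic_def hexagon_def ring_def top_edge_def induced_edges_def brick_edge_iff
        even_verts_def split: prod.splits)
  have "inj_on top_edge ?C"
    by (auto simp: inj_on_def top_edge_def doubleton_eq_iff prod_eq_iff)
  then have "card (top_edge ` ?C) = card ?C" by (rule card_image)
  then have cE: "card E + card ?C = card (brick U)"
    using card_Diff_subset[OF finite_subset[OF top] top] card_mono[OF _ top] finite_brick[OF assms]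
    unfolding E_def by simp
  have lo: "Min (snd ` U) \<le> b" if "(a, b) \<in> U" for a b
    by (rule Min_le[OF finite_imageI[OF assms] rev_image_eqI[OF that]]) simp
  have horiz: "((a, b), (a + 1, b)) \<in> reach E" if "(a, b) \<in> U" "(a + 1, b) \<in> U" "odd (a + b)" for a b
    by (rule reach_without_top_edges[OF lo E_def that])
  have "clusters U = card (components U E)"
    unfolding clusters_def
  proof (rule card_components_eq[OF assms Union_brick])
    show "E \<subseteq> brick U" by (auto simp: E_def)
    fix v w assume e: "{v, w} \<in> brick U"
    obtain a b c d where vw: "v = (a, b)" "w = (c, d)" by fastforce
    have UU: "(a, b) \<in> U" "(c, d) \<in> U" using e vw by (auto simp: induced_edges_def)
    show "(v, w) \<in> reach E"
    proof (cases "a = c")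
      case True
      then have "{v, w} \<in> E" using e unfolding E_def vw top_edge_def
        by (auto simp: doubleton_eq_iff)
      then show ?thesis by (rule reach_edge)
    next
      case False
      then have "b = d \<and> (c = a + 1 \<and> odd (a + b) \<or> a = c + 1 \<and> odd (c + d))"
        using e unfolding vw by (auto simp: induced_edges_def brick_edge_iff)
      then show ?thesis
      proof (elim conjE disjE)
        assume "b = d" "c = a + 1" "odd (a + b)"
        then show ?thesis using horiz[of a b] UU unfolding vw by simp
      next
        assume "b = d" "a = c + 1" "odd (c + d)"
        then show ?thesis using horiz[of c d, THEN reach_sym] UU unfolding vw by simp
      qed
    qed
  qed
  moreover have "card U \<le> card (components U E) + card E"
    using assms Union_brick[of U] finite_brick[OF assms]
    by (intro card_le_components_plus_edges)
      (auto simp: E_def induced_edges_def card_brick_edge)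
  ultimately show ?thesis using cE by linarith
qed

section \<open>Means over random subsets\<close>

definition weight :: "'a set \<Rightarrow> real \<Rightarrow> 'a set \<Rightarrow> real" where
  "weight V p U = p ^ card U * (1 - p) ^ card (V - U)"

text \<open>The expectation over a random open subset, as a finite sum, so that vertices can be
  added one at a time.\<close>

definition mean :: "'a set \<Rightarrow> real \<Rightarrow> ('a set \<Rightarrow> real) \<Rightarrow> real" where
  "mean V p g = (\<Sum>U\<in>Pow V. weight V p U * g U)"

lemma mean_cong: "(\<And>U. U \<subseteq> V \<Longrightarrow> g U = h U) \<Longrightarrow> mean V p g = mean V p h"
  unfolding mean_def by (intro sum.cong) auto

lemma mean_mono:
  assumes "0 \<le> p" "p \<le> 1" "\<And>U. U \<subseteq> V \<Longrightarrow> g U \<le> h U"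
  shows "mean V p g \<le> mean V p h"
  unfolding mean_def weight_def using assms by (intro sum_mono mult_left_mono) auto

lemma mean_add: "mean V p (\<lambda>U. g U + h U) = mean V p g + mean V p h"
  by (simp add: mean_def sum.distrib algebra_simps)

lemma mean_diff: "mean V p (\<lambda>U. g U - h U) = mean V p g - mean V p h"
  by (simp add: mean_def sum_subtractf algebra_simps)

lemma mean_sum: "mean V p (\<lambda>U. \<Sum>i\<in>I. g i U) = (\<Sum>i\<in>I. mean V p (g i))"
  unfolding mean_def by (simp add: sum_distrib_left sum.swap[of _ _ I])

text \<open>Conditioning on whether \<open>x\<close> is open.\<close>

lemma mean_insert:
  assumes "finite V" "x \<notin> V"
  shows "mean (insert x V) p g = p * mean V p (\<lambda>U. g (insert x U)) + (1 - p) * mean V p g"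
proof -
  have inj: "inj_on (insert x) (Pow V)" using assms by (auto simp: inj_on_def)
  have 1: "weight (insert x V) p U = (1 - p) * weight V p U" if "U \<in> Pow V" for U
  proof -
    have "insert x V - U = insert x (V - U)" using that assms by auto
    then show ?thesis using assms by (simp add: weight_def)
  qed
  have 2: "weight (insert x V) p (insert x U) = p * weight V p U" if "U \<in> Pow V" for U
  proof -
    have "insert x V - insert x U = V - U" "x \<notin> U" "finite U"
      using that assms finite_subset by auto
    then show ?thesis by (simp add: weight_def)
  qed
  have "mean (insert x V) p g = (\<Sum>U\<in>Pow V. weight (insert x V) p U * g U)
      + (\<Sum>U\<in>insert x ` Pow V. weight (insert x V) p U * g U)"
    unfolding mean_def Pow_insert using assms by (intro sum.union_disjoint) auto
  also have "(\<Sum>U\<in>Pow V. weight (insert x V) p U * g U) = (1 - p) * mean V p g"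
    unfolding mean_def sum_distrib_left by (intro sum.cong) (auto simp: 1)
  also have "(\<Sum>U\<in>insert x ` Pow V. weight (insert x V) p U * g U)
      = p * mean V p (\<lambda>U. g (insert x U))"
    unfolding mean_def sum_distrib_left sum.reindex[OF inj] by (intro sum.cong) (auto simp: 2)
  finally show ?thesis by simp
qed

text \<open>The form \<open>g (U \<inter> A)\<close> says that the variable depends on
  \<open>A\<close> alone; the vertices of \<open>B\<close> are averaged out one by one.\<close>

lemma mean_marginal_Un:
  assumes "finite B" "finite A" "A \<inter> B = {}"
  shows "mean (A \<union> B) p (\<lambda>U. g (U \<inter> A)) = mean A p g"
  using assms
proof (induction B rule: finite_induct)
  case empty
  then show ?case by (auto intro!: mean_cong arg_cong[of _ _ g])
next
  case (insert x B)
  then have "mean (A \<union> insert x B) p (\<lambda>U. g (U \<inter> A)) =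
     p * mean (A \<union> B) p (\<lambda>U. g (insert x U \<inter> A)) + (1 - p) * mean (A \<union> B) p (\<lambda>U. g (U \<inter> A))"
    by (simp add: mean_insert)
  also have "(\<lambda>U. g (insert x U \<inter> A)) = (\<lambda>U. g (U \<inter> A))" using insert.prems by auto
  finally show ?case using insert by (simp add: algebra_simps)
qed

lemma mean_marginal:
  assumes "finite V" "A \<subseteq> V"
  shows "mean V p (\<lambda>U. g (U \<inter> A)) = mean A p g"
proof -
  have "finite (V - A)" "finite A" "A \<inter> (V - A) = {}" "A \<union> (V - A) = V"
    using assms finite_subset by auto
  then show ?thesis using mean_marginal_Un[of "V - A" A p g] by simp
qed

lemma mean_const: "finite V \<Longrightarrow> mean V p (\<lambda>_. c) = c"
  using mean_marginal[of V "{}" p "\<lambda>_. c"] by (simp add: mean_def weight_def)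

lemma mean_cylinder:
  assumes "finite V" "S \<subseteq> V" "T \<subseteq> V" "S \<inter> T = {}"
  shows "mean V p (\<lambda>U. of_bool (S \<subseteq> U \<and> T \<inter> U = {})) = p ^ card S * (1 - p) ^ card T"
proof -
  let ?g = "\<lambda>U. of_bool (U = S) :: real"
  have "mean V p (\<lambda>U. of_bool (S \<subseteq> U \<and> T \<inter> U = {})) = mean V p (\<lambda>U. ?g (U \<inter> (S \<union> T)))"
    using assms by (intro mean_cong arg_cong[of _ _ of_bool]) blast
  also have "\<dots> = mean (S \<union> T) p ?g" using assms by (intro mean_marginal) auto
  also have "\<dots> = (\<Sum>U\<in>Pow (S \<union> T). if U = S then weight (S \<union> T) p S else 0)"
    unfolding mean_def by (intro sum.cong) auto
  also have "\<dots> = weight (S \<union> T) p S"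
    using assms finite_subset[of _ V] by (subst sum.delta) auto
  also have "S \<union> T - S = T" using assms by auto
  then have "weight (S \<union> T) p S = p ^ card S * (1 - p) ^ card T" by (simp add: weight_def)
  finally show ?thesis .
qed

lemma mean_superset:
  assumes "finite V" "S \<subseteq> V"
  shows "mean V p (\<lambda>U. of_bool (S \<subseteq> U)) = p ^ card S"
  using mean_cylinder[of V S "{}" p] assms by simp

lemma mean_image:
  assumes "inj_on f V"
  shows "mean (f ` V) p g = mean V p (\<lambda>U. g (f ` U))"
proof -
  have inj: "inj_on ((`) f) (Pow V)" using assms by (rule inj_on_image_Pow)
  have "weight (f ` V) p (f ` U) = weight V p U" if "U \<in> Pow V" for U
  proof -
    have "f ` V - f ` U = f ` (V - U)" using that assms by (auto simp: inj_on_def)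
    then show ?thesis using that assms
      by (auto simp: weight_def card_image inj_on_subset)
  qed
  then show ?thesis unfolding mean_def image_Pow_surj[OF refl, symmetric] sum.reindex[OF inj]
    by (intro sum.cong) auto
qed

lemma expected_components_eq_mean:
  fixes p :: real
  assumes "finite V" "0 \<le> p" "p \<le> 1"
  shows "expected_components V E p
    = mean V p (\<lambda>U. real (card (components U (induced_edges E U))))"
proof -
  let ?f = "\<lambda>U v. v \<in> U"
  have inj: "inj_on ?f (Pow V)" by (auto simp: inj_on_def fun_eq_iff)
  \<comment> \<open>The default value \<open>False\<close> outside \<open>V\<close> makes the
    configurations of positive probability indicator functions of subsets of
    \<open>V\<close>.\<close>
  have supp: "\<omega> \<in> ?f ` Pow V" if \<omega>: "\<omega> \<in> set_pmf (site_percolation V p)" for \<omega>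
  proof -
    have "\<omega> v = False" if "v \<notin> V" for v
      using set_Pi_pmf_subset[OF assms(1), of False "\<lambda>_. bernoulli_pmf p"] \<omega> that
      unfolding site_percolation_def by auto
    then show ?thesis by (intro image_eqI[of _ _ "{v. \<omega> v}"]) auto
  qed
  have w: "pmf (site_percolation V p) (?f U) = weight V p U" if "U \<in> Pow V" for U
  proof -
    have "pmf (site_percolation V p) (?f U) = (\<Prod>v\<in>V. pmf (bernoulli_pmf p) (v \<in> U))"
      unfolding site_percolation_def using assms that by (intro pmf_Pi') auto
    also have "\<dots> = (\<Prod>v\<in>V. if v \<in> U then p else 1 - p)"
      using assms by (intro prod.cong) auto
    also have "\<dots> = p ^ card (V \<inter> U) * (1 - p) ^ card (V \<inter> - U)"
      using assms by (subst prod.If_cases) auto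
    also have "V \<inter> U = U" using that by auto
    finally show ?thesis by (simp add: weight_def Diff_eq)
  qed
  have "expected_components V E p
      = (\<Sum>\<omega>\<in>?f ` Pow V. real (num_open_components V E \<omega>) * pmf (site_percolation V p) \<omega>)"
    unfolding expected_components_def using assms supp
    by (intro integral_measure_pmf_real) auto
  also have "\<dots> = (\<Sum>U\<in>Pow V. real (num_open_components V E (?f U)) * weight V p U)"
    unfolding sum.reindex[OF inj] using w by (intro sum.cong) auto
  also have "\<dots> = mean V p (\<lambda>U. real (card (components U (induced_edges E U))))"
    unfolding mean_def
  proof (intro sum.cong refl)
    fix U assume "U \<in> Pow V"
    then have "open_verts V (?f U) = U" by (auto simp: open_verts_def)
    then show "real (num_open_components V E (?f U)) * weight V p U =
        weight V p U * real (card (components U (induced_edges E U)))"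
      by (simp add: num_open_components_def)
  qed
  finally show ?thesis .
qed

section \<open>Mean number of clusters on the brick wall\<close>

definition mean_clusters :: "vertex set \<Rightarrow> real \<Rightarrow> real" where
  "mean_clusters V p = mean V p (\<lambda>U. real (clusters U))"

lemma mean_clusters_le_card:
  fixes p :: real
  assumes "finite V" "0 \<le> p" "p \<le> 1"
  shows "mean_clusters V p \<le> card V"
proof -
  have "mean_clusters V p \<le> mean V p (\<lambda>_. real (card V))"
    unfolding mean_clusters_def
  proof (rule mean_mono[OF assms(2,3)])
    fix U assume "U \<subseteq> V"
    then show "real (clusters U) \<le> real (card V)"
      using clusters_le_card[of U] card_mono[of V U] finite_subset[of U V] assms(1) by simp
  qed
  then show ?thesis by (simp add: mean_const assms)
qed

lemma mean_clusters_Un: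
  fixes p :: real
  assumes "finite A" "finite B" "0 \<le> p" "p \<le> 1"
  shows "mean_clusters (A \<union> B) p \<le> mean_clusters A p + mean_clusters B p"
proof -
  have "mean_clusters (A \<union> B) p
      \<le> mean (A \<union> B) p (\<lambda>U. real (clusters (U \<inter> A)) + real (clusters (U \<inter> B)))"
    unfolding mean_clusters_def
  proof (rule mean_mono[OF assms(3,4)])
    fix U assume U: "U \<subseteq> A \<union> B"
    then have "clusters U \<le> clusters (U \<inter> A) + clusters (U \<inter> B)"
      using clusters_Un[of "U \<inter> A" "U \<inter> B"] assms by (simp add: Int_Un_distrib[symmetric] Int_absorb2)
    then show "real (clusters U) \<le> real (clusters (U \<inter> A)) + real (clusters (U \<inter> B))" by linarith
  qed
  also have "\<dots> = mean_clusters A p + mean_clusters B p"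
    unfolding mean_add mean_clusters_def
    using mean_marginal[of "A \<union> B" A p "\<lambda>U. real (clusters U)"]
      mean_marginal[of "A \<union> B" B p "\<lambda>U. real (clusters U)"] assms by simp
  finally show ?thesis .
qed

lemma mean_clusters_UN:
  assumes "finite I" "\<And>i. i \<in> I \<Longrightarrow> finite (A i)" "0 \<le> p" "p \<le> 1"
  shows "mean_clusters (\<Union>i\<in>I. A i) p \<le> (\<Sum>i\<in>I. mean_clusters (A i) p)"
  using assms(1,2)
proof (induction I rule: finite_induct)
  case empty
  then show ?case using mean_clusters_le_card[of "{}" p] assms by simp
next
  case (insert i I)
  have "mean_clusters (\<Union>i\<in>insert i I. A i) p \<le> mean_clusters (A i) p + mean_clusters (\<Union>i\<in>I. A i) p"
    using insert assms mean_clusters_Un[of "A i" "\<Union>i\<in>I. A i" p] by simp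
  then show ?case using insert by simp
qed

definition shift :: "int \<Rightarrow> int \<Rightarrow> vertex \<Rightarrow> vertex" where
  "shift s t v = (fst v + s, snd v + t)"

lemma inj_shift: "inj (shift s t)"
  by (auto simp: inj_def shift_def prod_eq_iff)

text \<open>The position of horizontal edges depends on the parity of the coordinate sum, which
  \<open>(s, t)\<close> preserves when \<open>s + t\<close> is even. The inverse translation has the
  same parity, which gives the reverse inclusion.\<close>

lemma mean_clusters_shift:
  assumes "even (s + t)"
  shows "mean_clusters (shift s t ` V) p = mean_clusters V p"
proof -
  have edge: "shift s t ` e \<in> brick_edges" if "e \<in> brick_edges" "even (s + t)" for e s t
    using that(1)
  proof (cases rule: brick_edge_cases)
    case (1 a b)
    then show ?thesis by (auto simp: shift_def brick_edge_iff)
  next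
    case (2 a b)
    have "odd (a + s + (b + t))" using 2(2) that(2) by presburger
    then show ?thesis using 2(1) by (auto simp: shift_def brick_edge_iff)
  qed
  have brick: "brick (shift s t ` U) = (`) (shift s t) ` brick U" for U
  proof
    show "(`) (shift s t) ` brick U \<subseteq> brick (shift s t ` U)"
      using edge[OF _ assms] by (auto simp: induced_edges_def)
    show "brick (shift s t ` U) \<subseteq> (`) (shift s t) ` brick U"
    proof
      fix e assume e: "e \<in> brick (shift s t ` U)"
      have inv: "shift (- s) (- t) ` shift s t ` X = X" "shift s t ` shift (- s) (- t) ` X = X" for X
        by (force simp: shift_def image_image)+
      have "shift (- s) (- t) ` e \<in> brick_edges"
        using e assms by (intro edge) (auto simp: induced_edges_def)
      moreover have "shift (- s) (- t) ` e \<subseteq> U"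
        using image_mono[of e "shift s t ` U" "shift (- s) (- t)"] e
        unfolding inv by (simp add: induced_edges_def)
      ultimately show "e \<in> (`) (shift s t) ` brick U"
        by (intro image_eqI[of _ _ "shift (- s) (- t) ` e"]) (simp_all add: inv induced_edges_def)
    qed
  qed
  have "clusters (shift s t ` U) = clusters U" for U
    unfolding clusters_def brick by (rule card_components_image[OF inj_shift])
  then show ?thesis
    unfolding mean_clusters_def using inj_shift by (subst mean_image) (auto intro: inj_on_subset)
qed

section \<open>Expected numbers of vertices, edges, hooks and cycles\<close>

lemma mean_card:
  fixes p :: real
  assumes "finite V"
  shows "mean V p (\<lambda>U. real (card U)) = p * card V"
proof -
  have "mean V p (\<lambda>U. real (card U)) = mean V p (\<lambda>U. \<Sum>v\<in>V. of_bool ({v} \<subseteq> U))"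
    using assms by (intro mean_cong) (simp add: sum.If_cases Int_absorb1 of_bool_def)
  also have "\<dots> = p * card V" unfolding mean_sum using assms
    by (subst sum.cong[OF refl mean_superset]) auto
  finally show ?thesis .
qed

lemma mean_card_brick:
  fixes p :: real
  assumes "finite V"
  shows "mean V p (\<lambda>U. real (card (brick U))) = p\<^sup>2 * card (brick V)"
proof -
  have "mean V p (\<lambda>U. real (card (brick U))) = mean V p (\<lambda>U. \<Sum>e\<in>brick V. of_bool (e \<subseteq> U))"
  proof (rule mean_cong)
    fix U assume "U \<subseteq> V"
    then have "brick V \<inter> {e. e \<subseteq> U} = brick U" by (auto simp: induced_edges_def)
    then show "real (card (brick U)) = (\<Sum>e\<in>brick V. of_bool (e \<subseteq> U))"
      using finite_brick[OF assms] by (simp add: sum.If_cases of_bool_def)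
  qed
  also have "\<dots> = (\<Sum>e\<in>brick V. p\<^sup>2)" unfolding mean_sum
    using assms by (intro sum.cong) (auto simp: mean_superset induced_edges_def card_brick_edge)
  finally show ?thesis by simp
qed

text \<open>Near the boundary the pattern may stick out of \<open>V\<close>. Enlarging
  \<open>V\<close> to \<open>?W\<close> can only make the hook more likely, and there its
  probability is exact.\<close>

lemma mean_hook_le:
  fixes p :: real
  assumes "finite V" "0 \<le> p" "p \<le> 1"
  shows "mean V p (\<lambda>U. of_bool (hook v U)) \<le> p ^ 5 * (2 - p)"
proof -
  obtain c y where v: "v = (c, y)" by fastforce
  let ?S = "{(c, y), (c, y - 1), (c, y + 1), (c + 1, y - 1)}"
  let ?x = "(c + 1, y + 1)" and ?z = "(c, y + 2)"
  let ?W = "V \<union> insert ?x (insert ?z ?S)"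
  have "mean V p (\<lambda>U. of_bool (hook v U)) = mean ?W p (\<lambda>U. of_bool (hook v (U \<inter> V)))"
    by (rule mean_marginal[symmetric]) (use assms in auto)
  also have "\<dots> \<le> mean ?W p (\<lambda>U. of_bool (hook v U))"
    using hook_mono by (intro mean_mono assms) (auto simp: of_bool_def)
  \<comment> \<open>The alternative in \<open>hook\<close> is made disjoint: either
    \<open>?x\<close> is open, or \<open>?x\<close> is closed and \<open>?z\<close> is open.\<close>
  also have "\<dots> = mean ?W p (\<lambda>U. of_bool (insert ?x ?S \<subseteq> U) +
      of_bool (insert ?z ?S \<subseteq> U \<and> {?x} \<inter> U = {}))"
    by (intro mean_cong) (auto simp: hook_def v)
  also have "\<dots> = p ^ 5 + p ^ 5 * (1 - p)"
    unfolding mean_add using assms by (subst mean_superset, simp, simp) (subst mean_cylinder; simp add: eval_nat_numeral)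
  finally show ?thesis by (simp add: algebra_simps)
qed

lemma mean_clusters_upper:
  fixes p :: real
  assumes "finite V" "0 \<le> p" "p \<le> 1"
  shows "mean_clusters V p
    \<le> p * card V - p\<^sup>2 * card (brick V) + p ^ 5 * (2 - p) * card (V \<inter> even_verts)"
proof -
  have "mean_clusters V p \<le> mean V p (\<lambda>U. real (card U) - real (card (brick U)) +
      (\<Sum>v\<in>V \<inter> even_verts. of_bool (hook v U)))"
    unfolding mean_clusters_def
  proof (rule mean_mono[OF assms(2,3)])
    fix U assume U: "U \<subseteq> V"
    then have fin: "finite U" using assms finite_subset by auto
    have "{v \<in> U \<inter> even_verts. hook v U} \<subseteq> (V \<inter> even_verts) \<inter> {v. hook v U}" using U by auto
    then have "card {v \<in> U \<inter> even_verts. hook v U} \<le> card ((V \<inter> even_verts) \<inter> {v. hook v U})"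
      using assms by (intro card_mono) auto
    also have "real \<dots> = (\<Sum>v\<in>V \<inter> even_verts. of_bool (hook v U))"
      using assms by (simp add: of_bool_def sum.If_cases)
    finally show "real (clusters U) \<le> real (card U) - real (card (brick U)) +
        (\<Sum>v\<in>V \<inter> even_verts. of_bool (hook v U))"
      using clusters_plus_edges_le[OF fin] by linarith
  qed
  also have "\<dots> \<le> p * card V - p\<^sup>2 * card (brick V) + (\<Sum>v\<in>V \<inter> even_verts. p ^ 5 * (2 - p))"
    unfolding mean_add mean_diff mean_card[OF assms(1)] mean_card_brick[OF assms(1)] mean_sum
    by (intro add_left_mono sum_mono mean_hook_le assms)
  finally show ?thesis by (simp add: mult.commute)
qed

lemma card_hexagon: "finite (hexagon v)" "card (hexagon v) = 6"
  by (auto simp: hexagon_def card_cartesian_product split: prod.splits)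

lemma card_ring: "finite (ring v)" "card (ring v) = 12" "ring_centre v \<notin> ring v"
proof -
  obtain c y where v: "v = (c, y)" by fastforce
  have r: "ring v = {(c, y - 3), (c, y - 2), (c, y - 1), (c, y), (c, y + 1),
    (c + 1, y - 3), (c + 1, y - 2), (c + 1, y), (c + 1, y + 1),
    (c + 2, y - 2), (c + 2, y - 1), (c + 2, y)}" unfolding ring_def v by auto
  show "finite (ring v)" "card (ring v) = 12" unfolding r by simp_all
  show "ring_centre v \<notin> ring v" unfolding r by (simp add: ring_centre_def v)
qed

text \<open>\<open>H\<close> and \<open>R\<close> collect left corners whose hexagon, or whose ring
  with its centre, lies entirely in \<open>V\<close>, so that the cylinder probabilities are
  exact.\<close>

lemma mean_clusters_lower:
  fixes p :: real
  assumes "finite V" "0 \<le> p" "p \<le> 1"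
    and H: "finite H" "H \<subseteq> even_verts" "\<And>v. v \<in> H \<Longrightarrow> hexagon v \<subseteq> V"
    and R: "finite R" "R \<subseteq> even_verts" "\<And>v. v \<in> R \<Longrightarrow> insert (ring_centre v) (ring v) \<subseteq> V"
  shows "p * card V - p\<^sup>2 * card (brick V) + p ^ 6 * card H + p ^ 12 * (1 - p) * card R
    \<le> mean_clusters V p"
proof -
  have "p * card V - p\<^sup>2 * card (brick V) + p ^ 6 * card H + p ^ 12 * (1 - p) * card R =
     p * card V - p\<^sup>2 * card (brick V) + (\<Sum>v\<in>H. p ^ 6) + (\<Sum>v\<in>R. p ^ 12 * (1 - p))"
    by simp
  also have "(\<Sum>v\<in>H. p ^ 6) = (\<Sum>v\<in>H. mean V p (\<lambda>U. of_bool (hexagon v \<subseteq> U)))"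
    using H assms by (intro sum.cong) (simp_all add: mean_superset card_hexagon)
  also have "(\<Sum>v\<in>R. p ^ 12 * (1 - p)) =
      (\<Sum>v\<in>R. mean V p (\<lambda>U. of_bool (ring v \<subseteq> U \<and> {ring_centre v} \<inter> U = {})))"
    using R assms by (intro sum.cong refl) (subst mean_cylinder; simp add: card_ring)
  also have "p * card V - p\<^sup>2 * card (brick V) + (\<Sum>v\<in>H. mean V p (\<lambda>U. of_bool (hexagon v \<subseteq> U))) +
      (\<Sum>v\<in>R. mean V p (\<lambda>U. of_bool (ring v \<subseteq> U \<and> {ring_centre v} \<inter> U = {}))) =
      mean V p (\<lambda>U. real (card U) - real (card (brick U)) + (\<Sum>v\<in>H. of_bool (hexagon v \<subseteq> U)) +
       (\<Sum>v\<in>R. of_bool (ring v \<subseteq> U \<and> {ring_centre v} \<inter> U = {})))"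
    unfolding mean_add mean_diff mean_card[OF assms(1)] mean_card_brick[OF assms(1)] mean_sum ..
  also have "\<dots> \<le> mean_clusters V p"
    unfolding mean_clusters_def
  proof (rule mean_mono[OF assms(2,3)])
    fix U assume U: "U \<subseteq> V"
    then have fin: "finite U" using assms finite_subset by auto
    let ?A = "{v \<in> H. hexagon v \<subseteq> U}" and ?B = "{v \<in> R. ring v \<subseteq> U \<and> ring_centre v \<notin> U}"
    have "ring_centre v \<in> hexagon v" for v
      by (simp add: ring_centre_def hexagon_def split: prod.splits)
    then have "?A \<inter> ?B = {}" by blast
    then have "card ?A + card ?B = card (?A \<union> ?B)"
      using H R by (intro card_Un_disjoint[symmetric]) auto
    also have "\<dots> \<le> card {v \<in> even_verts. cyclic v U}"
    proof (rule card_mono)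
      have "v \<in> U" if "cyclic v U" for v
        using that by (auto simp: cyclic_def hexagon_def ring_def split: prod.splits)
      then show "finite {v \<in> even_verts. cyclic v U}" using fin by (auto intro: finite_subset[of _ U])
      show "?A \<union> ?B \<subseteq> {v \<in> even_verts. cyclic v U}" using H R by (auto simp: cyclic_def)
    qed
    finally have "card U + (card ?A + card ?B) \<le> clusters U + card (brick U)"
      using card_plus_cyclic_le[OF fin] by linarith
    moreover have "(\<Sum>v\<in>H. of_bool (hexagon v \<subseteq> U)) = real (card ?A)"
      using H by (simp add: of_bool_def sum.If_cases Collect_conj_eq)
    moreover have "(\<Sum>v\<in>R. of_bool (ring v \<subseteq> U \<and> {ring_centre v} \<inter> U = {})) = real (card ?B)"
      using R by (simp add: of_bool_def sum.If_cases Collect_conj_eq)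
    ultimately show "real (card U) - real (card (brick U)) + (\<Sum>v\<in>H. of_bool (hexagon v \<subseteq> U)) +
       (\<Sum>v\<in>R. of_bool (ring v \<subseteq> U \<and> {ring_centre v} \<inter> U = {})) \<le> real (clusters U)"
      by linarith
  qed
  finally show ?thesis .
qed

section \<open>The hexagonal lattice as a part of the brick wall\<close>

text \<open>Every vertical line borders an even, hence full, column of hexagons, except the last
  line for even \<open>m\<close>: it borders only the odd column \<open>m - 1\<close>, which is one
  hexagon shorter, and so loses its lowest and highest vertex.\<close>

definition region :: "nat \<Rightarrow> vertex set" where
  "region m = {0..int m} \<times> {-1..2 * int m - 1} -
     (if even m then {(int m, -1), (int m, 2 * int m - 1)} else {})"

text \<open>An even vertex is the left corner of a hexagon centred at abscissa 3c/2, hence sits at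
  3c/2 - 1; an odd vertex lies 1/2 further right. Rows are half a hexagon height apart.\<close>

definition place :: "vertex \<Rightarrow> complex" where
  "place v = (case v of (c, y) \<Rightarrow>
     Complex ((3 * real_of_int c - 2 + (if even (c + y) then 0 else 1)) / 2) (sqrt 3 / 2 * real_of_int y))"

lemma Re_place: "2 * Re (place (c, y)) = real_of_int (3 * c - 2 + (if even (c + y) then 0 else 1))"
  by (simp add: place_def)

lemma inj_place: "inj place"
proof (rule injI)
  fix v w assume eq: "place v = place w"
  obtain c y d z where vw: "v = (c, y)" "w = (d, z)" by fastforce
  have y: "y = z" using arg_cong[OF eq, of Im] unfolding vw place_def by simp
  have "3 * c - 2 + (if even (c + y) then 0 else 1) = 3 * d - 2 + (if even (d + z) then 0 else 1)"
    using Re_place[of c y] Re_place[of d z] eq unfolding vw by (simp only: of_int_eq_iff)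
  \<comment> \<open>The offsets 0 and 1 differ by less than 3, so the multiple of 3 is
    determined.\<close>
  then have "c = d" by presburger
  then show "v = w" using y vw by simp
qed

text \<open>Counterclockwise from angle 0. The seventh entry repeats the first, so that
  \<open>Suc k\<close> makes sense for the last side.\<close>

definition corner :: "vertex \<Rightarrow> nat \<Rightarrow> vertex" where
  "corner v k = (case v of (c, y) \<Rightarrow>
     [(c + 1, y), (c + 1, y + 1), (c, y + 1), (c, y), (c, y - 1), (c + 1, y - 1), (c + 1, y)] ! k)"

lemma less_6_cases: "k < (6::nat) \<longleftrightarrow> k = 0 \<or> k = 1 \<or> k = 2 \<or> k = 3 \<or> k = 4 \<or> k = 5"
  by auto

lemma place_corner:
  assumes "even (c + y)" "k \<le> 6"
  shows "place (corner (c, y) k) =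
    Complex (3 / 2 * real_of_int c) (sqrt 3 / 2 * real_of_int y) + cis (real k * pi / 3)"
proof -
  let ?w = "Complex (1 / 2) (sqrt 3 / 2)"
  have w: "cis (pi / 3) = ?w" by (simp add: complex_eq_iff cos_60 sin_60)
  have w2: "?w ^ 2 = Complex (- 1 / 2) (sqrt 3 / 2)"
    by (simp add: complex_eq_iff power2_eq_square)
  have w3: "?w ^ 3 = - 1" by (simp add: complex_eq_iff power3_eq_cube)
  have w4: "?w ^ 4 = - ?w" using w3 by (simp add: eval_nat_numeral)
  have w5: "?w ^ 5 = - (?w ^ 2)" using w3 by (simp add: eval_nat_numeral)
  have w6: "?w ^ 6 = 1" using w3 by (simp add: eval_nat_numeral)
  have cis: "cis (real k * pi / 3) = ?w ^ k" unfolding w[symmetric] Complex.DeMoivre by simp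
  have par: "odd (c + 1 + y)" "even (c + 1 + (y + 1))" "even (c + 1 + (y - 1))"
    "odd (c + (y + 1))" "odd (c + (y - 1))" using assms(1) by presburger+
  have "k = 0 \<or> k = 1 \<or> k = 2 \<or> k = 3 \<or> k = 4 \<or> k = 5 \<or> k = 6" using assms by auto
  then consider "k = 0" | "k = 1" | "k = 2" | "k = 3" | "k = 4" | "k = 5" | "k = 6" by blast
  then show ?thesis
  proof cases
    case 1
    have a: "corner (c, y) k = (c + 1, y)" by (simp add: corner_def 1)
    have b: "?w ^ k = Complex 1 0" by (simp add: complex_eq_iff 1)
    show ?thesis unfolding cis a b using par by (simp add: place_def complex_eq_iff field_simps)
  next
    case 2
    have a: "corner (c, y) k = (c + 1, y + 1)" by (simp add: corner_def 2)
    have b: "?w ^ k = ?w" by (simp add: 2)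
    show ?thesis unfolding cis a b using par by (simp add: place_def complex_eq_iff field_simps)
  next
    case 3
    have a: "corner (c, y) k = (c, y + 1)" by (simp add: corner_def 3)
    have b: "?w ^ k = Complex (- 1 / 2) (sqrt 3 / 2)" by (simp only: w2 3)
    show ?thesis unfolding cis a b using par by (simp add: place_def complex_eq_iff field_simps)
  next
    case 4
    have a: "corner (c, y) k = (c, y)" by (simp add: corner_def 4)
    have b: "?w ^ k = Complex (- 1) 0" unfolding 4 w3 by (simp add: complex_eq_iff)
    show ?thesis unfolding cis a b using assms by (simp add: place_def complex_eq_iff field_simps)
  next
    case 5
    have a: "corner (c, y) k = (c, y - 1)" by (simp add: corner_def 5)
    have b: "?w ^ k = Complex (- 1 / 2) (- sqrt 3 / 2)"
      unfolding 5 w4 by (simp add: complex_eq_iff)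
    show ?thesis unfolding cis a b using par by (simp add: place_def complex_eq_iff field_simps)
  next
    case 6
    have a: "corner (c, y) k = (c + 1, y - 1)" by (simp add: corner_def 6)
    have b: "?w ^ k = Complex (1 / 2) (- sqrt 3 / 2)"
      unfolding 6 w5 w2 by (simp add: complex_eq_iff)
    show ?thesis unfolding cis a b using par by (simp add: place_def complex_eq_iff field_simps)
  next
    case 7
    have a: "corner (c, y) k = (c + 1, y)" by (simp add: corner_def 7)
    have b: "?w ^ k = Complex 1 0" unfolding 7 w6 by (simp add: complex_eq_iff)
    show ?thesis unfolding cis a b using par by (simp add: place_def complex_eq_iff field_simps)
  qed
qed

lemma hex_corner_eq_place:
  assumes "k \<le> 6"
  shows "hex_corner (hex_centre j i) k = place (corner (int j, 2 * int i + int (j mod 2)) k)"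
proof -
  have par: "even (int j + (2 * int i + int (j mod 2)))" by presburger
  show ?thesis
    unfolding place_corner[OF par assms] hex_corner_def hex_centre_def
    by (simp add: algebra_simps)
qed

text \<open>The left corners of the hexagons: a hexagon is two rows high, and odd columns are raised
  by one row.\<close>

definition hex_origins :: "nat \<Rightarrow> vertex set" where
  "hex_origins m = {(int j, 2 * int i + int (j mod 2)) | j i. j < m \<and> i < (if even j then m else m - 1)}"

lemma hex_origins_iff:
  "(c, y) \<in> hex_origins m \<longleftrightarrow> 0 \<le> c \<and> c < int m \<and> even (c + y) \<and>
     (if even c then 0 \<le> y \<and> y \<le> 2 * int m - 2 else 1 \<le> y \<and> y \<le> 2 * int m - 3)"
    (is "_ \<longleftrightarrow> ?R")
proof
  assume "(c, y) \<in> hex_origins m"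
  then obtain j i where ji: "c = int j" "y = 2 * int i + int (j mod 2)" "j < m"
    "i < (if even j then m else m - 1)" unfolding hex_origins_def by auto
  show ?R
  proof (cases "even j")
    case True
    then show ?thesis using ji by auto
  next
    case False
    then have "int (j mod 2) = 1" by presburger
    then show ?thesis using ji False by auto
  qed
next
  assume R: ?R
  have "c mod 2 = int (nat c mod 2)" using R by (simp add: zmod_int)
  show "(c, y) \<in> hex_origins m"
  proof (cases "even c")
    case True
    then have "even (nat c)" using R by (simp add: even_nat_iff)
    then have "nat c < m \<and> nat (y div 2) < (if even (nat c) then m else m - 1)"
      "c = int (nat c)" "y = 2 * int (nat (y div 2)) + int (nat c mod 2)"
      using R True by auto
    then show ?thesis unfolding hex_origins_def by blast
  next
    case False
    then have "odd (nat c)" "nat c mod 2 = 1" "odd y" using R by (auto simp: even_nat_iff) presburger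
    then have "nat c < m \<and> nat (y div 2) < (if even (nat c) then m else m - 1)"
      "c = int (nat c)" "y = 2 * int (nat (y div 2)) + int (nat c mod 2)"
      using R False by auto
    then show ?thesis unfolding hex_origins_def by blast
  qed
qed

lemma hex_verts_eq_image: "hex_verts m = place ` {corner v k | v k. v \<in> hex_origins m \<and> k < 6}"
proof
  show "hex_verts m \<subseteq> place ` {corner v k | v k. v \<in> hex_origins m \<and> k < 6}"
  proof
    fix z assume "z \<in> hex_verts m"
    then obtain j i k where *: "j < m" "i < (if even j then m else m - 1)" "k < 6"
      "z = hex_corner (hex_centre j i) k"
      unfolding hex_verts_def hex_centres_def by blast
    have "(int j, 2 * int i + int (j mod 2)) \<in> hex_origins m" using * unfolding hex_origins_def by blast
    then show "z \<in> place ` {corner v k | v k. v \<in> hex_origins m \<and> k < 6}"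
      using * by (simp only: hex_corner_eq_place[OF less_imp_le]) blast
  qed
  show "place ` {corner v k | v k. v \<in> hex_origins m \<and> k < 6} \<subseteq> hex_verts m"
  proof
    fix z assume "z \<in> place ` {corner v k | v k. v \<in> hex_origins m \<and> k < 6}"
    then obtain j i k where *: "j < m" "i < (if even j then m else m - 1)" "k < 6"
      "z = place (corner (int j, 2 * int i + int (j mod 2)) k)" unfolding hex_origins_def by blast
    then have "z = hex_corner (hex_centre j i) k" by (simp only: hex_corner_eq_place[OF less_imp_le])
    then show "z \<in> hex_verts m" unfolding hex_verts_def hex_centres_def using * by blast
  qed
qed

lemma hex_edges_eq_image:
  "hex_edges m = (`) place ` {{corner v k, corner v (Suc k)} | v k. v \<in> hex_origins m \<and> k < 6}"
proof
  show "hex_edges m \<subseteq> (`) place ` {{corner v k, corner v (Suc k)} | v k. v \<in> hex_origins m \<and> k < 6}"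
  proof
    fix e assume "e \<in> hex_edges m"
    then obtain j i k where *: "j < m" "i < (if even j then m else m - 1)" "k < 6"
      "e = {hex_corner (hex_centre j i) k, hex_corner (hex_centre j i) (Suc k)}"
      unfolding hex_edges_def hex_centres_def by blast
    let ?v = "(int j, 2 * int i + int (j mod 2))"
    have "?v \<in> hex_origins m" using * unfolding hex_origins_def by blast
    moreover have "e = place ` {corner ?v k, corner ?v (Suc k)}"
      using * by (simp add: hex_corner_eq_place)
    ultimately show "e \<in> (`) place ` {{corner v k, corner v (Suc k)} | v k. v \<in> hex_origins m \<and> k < 6}"
      using *(3) by blast
  qed
  show "(`) place ` {{corner v k, corner v (Suc k)} | v k. v \<in> hex_origins m \<and> k < 6} \<subseteq> hex_edges m"
  proof
    fix e assume "e \<in> (`) place ` {{corner v k, corner v (Suc k)} | v k. v \<in> hex_origins m \<and> k < 6}"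
    then obtain v k where v: "v \<in> hex_origins m" "k < 6" "e = place ` {corner v k, corner v (Suc k)}"
      by blast
    then obtain j i where *: "j < m" "i < (if even j then m else m - 1)"
      "v = (int j, 2 * int i + int (j mod 2))" unfolding hex_origins_def by blast
    then have "e = {hex_corner (hex_centre j i) k, hex_corner (hex_centre j i) (Suc k)}"
      using v by (simp add: hex_corner_eq_place)
    then show "e \<in> hex_edges m" unfolding hex_edges_def hex_centres_def using * v by blast
  qed
qed

lemma region_iff:
  "(c, y) \<in> region m \<longleftrightarrow> 0 \<le> c \<and> c \<le> int m \<and> -1 \<le> y \<and> y \<le> 2 * int m - 1 \<and>
     (even c \<and> c = int m \<longrightarrow> y \<noteq> -1 \<and> y \<noteq> 2 * int m - 1)"
  by (auto simp: region_def)

lemma finite_region: "finite (region m)"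
  by (simp add: region_def)

lemma vertical_side:
  assumes "(c, y) \<in> region m" "(c, y + 1) \<in> region m"
  obtains d z where "(d, z) \<in> hex_origins m" "d = c \<or> d + 1 = c" "z = y \<or> z = y + 1"
proof -
  have r: "0 \<le> c" "c \<le> int m" "-1 \<le> y" "y + 1 \<le> 2 * int m - 1" 
    "even c \<Longrightarrow> c = int m \<Longrightarrow> y \<noteq> -1" "even c \<Longrightarrow> c = int m \<Longrightarrow> y + 1 \<noteq> 2 * int m - 1"
    using assms by (auto simp: region_iff)
  \<comment> \<open>The even column next to line \<open>c\<close> is preferred because it is full;
    only on the last line of an even \<open>m\<close> must the odd column \<open>m - 1\<close> be
    used.\<close>
  define d where "d = (if odd c \<or> c = int m then c - 1 else c)"
  define z where "z = (if even (d + y) then y else y + 1)"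
  have "(d, z) \<in> hex_origins m"
  proof (cases "even c \<and> c = int m")
    case True
    then have "c \<noteq> 0" using r by auto
    then show ?thesis using r True unfolding hex_origins_iff d_def z_def
      by (auto split: if_splits) presburger+
  next
    case False
    then show ?thesis using r unfolding hex_origins_iff d_def z_def
      by (auto split: if_splits) presburger+
  qed
  then show thesis by (rule that) (auto simp: d_def z_def)
qed

lemma horizontal_side:
  assumes "(c, y) \<in> region m" "(c + 1, y) \<in> region m" "odd (c + y)"
  obtains z where "(c, z) \<in> hex_origins m" "z = y - 1 \<or> z = y + 1"
proof -
  have r: "0 \<le> c" "c + 1 \<le> int m" "-1 \<le> y" "y \<le> 2 * int m - 1" 
    using assms by (auto simp: region_iff)
  \<comment> \<open>The edge is the top side of the hexagon below it, except in the lowest rows,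
    where it is the bottom side of the one above.\<close>
  define z where "z = (if y \<le> 0 then y + 1 else y - 1)"
  have "(c, z) \<in> hex_origins m"
    using r assms(3) unfolding hex_origins_iff z_def by (auto split: if_splits) presburger+
  then show thesis by (rule that) (auto simp: z_def)
qed

lemma corner_in_region:
  assumes "v \<in> hex_origins m" "k \<le> 6"
  shows "corner v k \<in> region m"
proof -
  obtain c y where v: "v = (c, y)" by fastforce
  have o: "0 \<le> c" "c < int m" "even (c + y)"
     "if even c then 0 \<le> y \<and> y \<le> 2 * int m - 2 else 1 \<le> y \<and> y \<le> 2 * int m - 3"
    using assms unfolding v hex_origins_iff by auto
  have "(d, z) \<in> region m" if "d = c \<or> d = c + 1" "z = y - 1 \<or> z = y \<or> z = y + 1" for d z
    using that o unfolding region_iff by (auto split: if_splits; presburger)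
  moreover have "k = 0 \<or> k = 1 \<or> k = 2 \<or> k = 3 \<or> k = 4 \<or> k = 5 \<or> k = 6" using assms by auto
  ultimately show ?thesis unfolding v corner_def by (elim disjE) (simp_all add: eval_nat_numeral)
qed

lemma side_in_brick:
  assumes "v \<in> hex_origins m" "k < 6"
  shows "{corner v k, corner v (Suc k)} \<in> brick (region m)"
proof -
  obtain c y where v: "v = (c, y)" by fastforce
  have "even (c + y)" using assms unfolding v hex_origins_iff by auto
  then have "{corner v k, corner v (Suc k)} \<in> brick_edges"
    using assms(2)[unfolded less_6_cases] unfolding v corner_def
    by (elim disjE) (simp_all add: eval_nat_numeral brick_edge_iff)
  then show ?thesis using corner_in_region[OF assms(1)] assms(2) by (auto simp: induced_edges_def)
qed

lemma side_of_hexagon: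
  assumes "e \<in> brick (region m)"
  obtains v k where "v \<in> hex_origins m" "k < 6" "e = {corner v k, corner v (Suc k)}"
proof -
  have e: "e \<in> brick_edges" "e \<subseteq> region m" using assms by (auto simp: induced_edges_def)
  from e(1) show thesis
  proof (cases rule: brick_edge_cases)
    case (1 c y)
    then obtain d z where dz: "(d, z) \<in> hex_origins m" "d = c \<or> d + 1 = c" "z = y \<or> z = y + 1"
      using e(2) vertical_side[of c y m] by auto
    have "\<exists>k<6. e = {corner (d, z) k, corner (d, z) (Suc k)}"
    proof -
      consider "d = c" "z = y" | "d = c" "z = y + 1" | "d + 1 = c" "z = y" | "d + 1 = c" "z = y + 1"
        using dz by blast
      then show ?thesis
      proof cases
        case 1
        then show ?thesis unfolding \<open>e = _\<close>
          by (intro exI[of _ 2]) (simp add: corner_def eval_nat_numeral insert_commute)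
      next
        case 2
        then show ?thesis unfolding \<open>e = _\<close>
          by (intro exI[of _ 3]) (simp add: corner_def eval_nat_numeral insert_commute)
      next
        case 3
        then show ?thesis unfolding \<open>e = _\<close>
          by (intro exI[of _ 0]) (auto simp: corner_def eval_nat_numeral)
      next
        case 4
        then show ?thesis unfolding \<open>e = _\<close>
          by (intro exI[of _ 5]) (auto simp: corner_def eval_nat_numeral)
      qed
    qed
    then show thesis using that dz by blast
  next
    case (2 c y)
    then obtain z where z: "(c, z) \<in> hex_origins m" "z = y - 1 \<or> z = y + 1"
      using e(2) horizontal_side[of c y m] by auto
    have "\<exists>k<6. e = {corner (c, z) k, corner (c, z) (Suc k)}"
      using z(2)
    proof
      assume "z = y - 1"
      then show ?thesis unfolding \<open>e = _\<close>
        by (intro exI[of _ 1]) (auto simp: corner_def eval_nat_numeral)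
    next
      assume "z = y + 1"
      then show ?thesis unfolding \<open>e = _\<close>
        by (intro exI[of _ 4]) (auto simp: corner_def eval_nat_numeral)
    qed
    then show thesis using that z by blast
  qed
qed

lemma hex_edges_eq: "hex_edges m = (`) place ` brick (region m)"
proof -
  have "{{corner v k, corner v (Suc k)} | v k. v \<in> hex_origins m \<and> k < 6} = brick (region m)"
    using side_in_brick side_of_hexagon by (auto; metis)
  then show ?thesis by (simp add: hex_edges_eq_image)
qed

text \<open>With no isolated vertices, the description of the vertex set follows from that of the
  edges.\<close>

lemma region_has_edge:
  assumes "v \<in> region m" "m \<ge> 1"
  shows "\<exists>w. {v, w} \<in> brick (region m)"
proof -
  obtain c y where v: "v = (c, y)" by fastforce
  have "(c, y + 1) \<in> region m \<or> (c, y - 1) \<in> region m"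
    using assms unfolding v region_iff by (cases "y \<le> 0"; auto; presburger)
  then obtain z where "(c, z) \<in> region m" "z = y + 1 \<or> y = z + 1" by force
  then show ?thesis using assms(1) unfolding v
    by (intro exI[of _ "(c, z)"]) (auto simp: induced_edges_def brick_edge_iff)
qed

lemma hex_verts_eq:
  assumes "m \<ge> 1"
  shows "hex_verts m = place ` region m"
proof -
  have "{corner v k | v k. v \<in> hex_origins m \<and> k < 6} = region m"
  proof
    show "{corner v k | v k. v \<in> hex_origins m \<and> k < 6} \<subseteq> region m"
      using corner_in_region by auto
    show "region m \<subseteq> {corner v k | v k. v \<in> hex_origins m \<and> k < 6}"
    proof
      fix u assume "u \<in> region m"
      then obtain w where "{u, w} \<in> brick (region m)" using region_has_edge assms by blast
      then obtain v k where vk: "v \<in> hex_origins m" "k < 6" "{u, w} = {corner v k, corner v (Suc k)}"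
        by (rule side_of_hexagon)
      have "corner v 6 = corner v 0" by (simp add: corner_def eval_nat_numeral split: prod.splits)
      have "\<exists>k<6. u = corner v k"
      proof (cases "u = corner v k")
        case False
        then have u: "u = corner v (Suc k)" using vk by blast
        \<comment> \<open>For \<open>k = 5\<close> the successor index 6 leaves the range of
          corners, but it denotes corner 0 again.\<close>
        show ?thesis
        proof (cases "k = 5")
          case True
          then show ?thesis using u \<open>corner v 6 = corner v 0\<close> by (intro exI[of _ 0]) simp
        qed (use u vk in \<open>auto intro: exI[of _ "Suc k"]\<close>)
      qed (use vk in blast)
      then show "u \<in> {corner v k | v k. v \<in> hex_origins m \<and> k < 6}" using vk by blast
    qed
  qed
  then show ?thesis by (simp add: hex_verts_eq_image)
qed

lemma card_hex_verts: "m \<ge> 1 \<Longrightarrow> card (hex_verts m) = card (region m)"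
  using inj_place by (simp add: hex_verts_eq card_image inj_on_subset)

lemma expected_components_hex:
  fixes p :: real
  assumes "m \<ge> 1" "0 \<le> p" "p \<le> 1"
  shows "expected_components (hex_verts m) (hex_edges m) p = mean_clusters (region m) p"
proof -
  have "expected_components (hex_verts m) (hex_edges m) p
      = mean (region m) p (\<lambda>U. real (card (components (place ` U) (induced_edges (hex_edges m) (place ` U)))))"
    using assms inj_place finite_region
    by (simp add: hex_verts_eq expected_components_eq_mean mean_image inj_on_subset)
  also have "\<dots> = mean_clusters (region m) p"
    unfolding mean_clusters_def
  proof (rule mean_cong)
    fix U assume U: "U \<subseteq> region m"
    have "induced_edges (hex_edges m) (place ` U) = (`) place ` brick U"
      using U inj_place unfolding hex_edges_eq
      by (auto simp: induced_edges_def inj_image_subset_iff)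
    then show "real (card (components (place ` U) (induced_edges (hex_edges m) (place ` U)))) = clusters U"
      by (simp add: clusters_def card_components_image[OF inj_place])
  qed
  finally show ?thesis .
qed

section \<open>Vertices, edges and hexagons of the region\<close>

lemma card_region_le: "card (region m) \<le> (m + 1) * (2 * m + 1)"
proof -
  have "card (region m) \<le> card ({0..int m} \<times> {-1..2 * int m - 1})"
    by (intro card_mono) (auto simp: region_def)
  also have "\<dots> = (m + 1) * (2 * m + 1)" by (simp add: card_cartesian_product nat_add_distrib nat_mult_distrib)
  finally show ?thesis .
qed

lemma rectangle_subset_region: "{0..int m - 1} \<times> {-1..2 * int m - 1} \<subseteq> region m"
  by (auto simp: region_def)

lemma card_region_ge: "2 * m\<^sup>2 \<le> card (region m)"
proof -
  have "2 * m\<^sup>2 \<le> m * (2 * m + 1)" by (simp add: power2_eq_square)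
  also have "\<dots> = card ({0..int m - 1} \<times> {-1..2 * int m - 1})"
    by (simp add: card_cartesian_product nat_add_distrib nat_mult_distrib)
  also have "\<dots> \<le> card (region m)" by (rule card_mono[OF finite_region rectangle_subset_region])
  finally show ?thesis .
qed

text \<open>On one line a parity class contains at most one of the rows 2k and 2k + 1, so
  \<open>y div 2\<close> identifies its vertices. The value -1 accounts for row -1.\<close>

lemma card_parity_class_le:
  assumes "W \<subseteq> region m" "\<And>c y d z. (c, y) \<in> W \<Longrightarrow> (d, z) \<in> W \<Longrightarrow> even (c + y) \<longleftrightarrow> even (d + z)"
  shows "card W \<le> (m + 1)\<^sup>2"
proof -
  have "card W \<le> card ({0..int m} \<times> {-1..int m - 1})"
  proof (rule card_inj_on_le[where f = "\<lambda>(c, y). (c, y div 2)"])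
    show "inj_on (\<lambda>(c, y). (c, y div 2)) W"
    proof (rule inj_onI, clarsimp)
      fix c y z assume "(c, y) \<in> W" "(c, z) \<in> W" "y div 2 = z div 2"
      moreover from this have "even (c + y) \<longleftrightarrow> even (c + z)" using assms(2) by blast
      ultimately show "y = z" by presburger
    qed
    show "(\<lambda>(c, y). (c, y div 2)) ` W \<subseteq> {0..int m} \<times> {-1..int m - 1}"
    proof
      fix w assume "w \<in> (\<lambda>(c, y). (c, y div 2)) ` W"
      then obtain c y where cy: "(c, y) \<in> W" "w = (c, y div 2)" by auto
      then have "0 \<le> c" "c \<le> int m" "-1 \<le> y" "y \<le> 2 * int m - 1"
        using assms(1) region_iff by blast+
      then show "w \<in> {0..int m} \<times> {-1..int m - 1}" unfolding cy by simp presburger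
    qed
  qed simp
  also have "\<dots> = (m + 1)\<^sup>2" by (simp add: card_cartesian_product power2_eq_square nat_add_distrib)
  finally show ?thesis .
qed

lemma card_region_even_le: "card (region m \<inter> even_verts) \<le> (m + 1)\<^sup>2"
  by (rule card_parity_class_le) (auto simp: even_verts_def)

lemma card_brick_region_le: "card (brick (region m)) \<le> (m + 1) * (3 * m + 2)"
proof -
  have "brick (region m) \<subseteq> vert_edge ` region m \<union> horiz_edge ` (region m - even_verts)"
    by (auto simp: induced_edges_def brick_edges_def vert_edge_def horiz_edge_def)
  then have "card (brick (region m)) \<le> card (vert_edge ` region m \<union> horiz_edge ` (region m - even_verts))"
    using finite_region by (intro card_mono) auto
  also have "\<dots> \<le> card (region m) + card (region m - even_verts)"
    by (intro order.trans[OF card_Un_le] add_mono card_image_le) (simp_all add: finite_region)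
  also have "card (region m - even_verts) \<le> (m + 1)\<^sup>2"
    by (rule card_parity_class_le) (auto simp: even_verts_def)
  finally show ?thesis using card_region_le[of m] by (simp add: power2_eq_square algebra_simps)
qed

lemma card_brick_region_ge: "3 * m\<^sup>2 \<le> card (brick (region m)) + m"
proof (cases "m = 0")
  case False
  \<comment> \<open>The ranges avoid the last line, where the region may be truncated. The parity
    term in \<open>?g\<close> selects the odd vertices, from which horizontal edges start.\<close>
  let ?P = "{0..int m - 1} \<times> {-1..2 * int m - 2}" and ?Q = "{0..int m - 2} \<times> {0..int m - 1}"
  let ?g = "\<lambda>(c, k). horiz_edge (c, 2 * k + (if even c then 1 else 0))"
  have ivert: "inj_on vert_edge ?P"
    by (auto simp: inj_on_def vert_edge_def doubleton_eq_iff)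
  have ihoriz: "inj_on ?g ?Q"
    by (auto simp: inj_on_def horiz_edge_def doubleton_eq_iff)
  have disj: "vert_edge ` ?P \<inter> ?g ` ?Q = {}"
    by (auto simp: vert_edge_def horiz_edge_def doubleton_eq_iff)
  have vsub: "vert_edge ` ?P \<subseteq> brick (region m)"
    by (auto simp: vert_edge_def induced_edges_def brick_edge_iff region_iff)
  have hsub: "?g ` ?Q \<subseteq> brick (region m)"
    by (auto simp: horiz_edge_def induced_edges_def brick_edge_iff region_iff)
  have "card (vert_edge ` ?P \<union> ?g ` ?Q) = card ?P + card ?Q"
    using disj by (subst card_Un_disjoint) (simp_all add: card_image[OF ivert] card_image[OF ihoriz])
  also have "card ?P = m * (2 * m)" by (simp add: card_cartesian_product nat_mult_distrib)
  also have "card ?Q = (m - 1) * m"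
    by (simp add: card_cartesian_product nat_diff_distrib')
  finally have "m * (2 * m) + (m - 1) * m \<le> card (brick (region m))"
    using card_mono[OF finite_brick[OF finite_region], of "vert_edge ` ?P \<union> ?g ` ?Q" m] vsub hsub
    by auto
  moreover have "3 * m\<^sup>2 = m * (2 * m) + (m - 1) * m + m"
    using False by (cases m) (simp_all add: power2_eq_square algebra_simps)
  ultimately show ?thesis by linarith
qed simp

text \<open>To leading order there are 2m^2 vertices, 3m^2 edges and m^2 even vertices; the linear
  deviations \<open>3 * m + 1\<close>, \<open>m\<close> and \<open>2 * m + 1\<close> add up to an
  error that does not depend on \<open>p\<close>.\<close>

lemma mean_clusters_region_upper:
  fixes p :: real
  assumes "0 \<le> p" "p \<le> 1"
  shows "mean_clusters (region m) p \<le> 2 * (real m)\<^sup>2 * (p - 3 / 2 * p\<^sup>2 + p ^ 5 * (2 - p) / 2) + 6 * m + 2"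
proof -
  have "real (card (region m)) \<le> real ((m + 1) * (2 * m + 1))"
    by (rule of_nat_mono[OF card_region_le])
  then have N: "real (card (region m)) \<le> 2 * (real m)\<^sup>2 + (3 * m + 1)"
    by (simp add: power2_eq_square algebra_simps)
  have "real (3 * m\<^sup>2) \<le> real (card (brick (region m)) + m)"
    by (rule of_nat_mono[OF card_brick_region_ge])
  then have B: "3 * (real m)\<^sup>2 - m \<le> real (card (brick (region m)))" by simp
  have "real (card (region m \<inter> even_verts)) \<le> real ((m + 1)\<^sup>2)"
    by (rule of_nat_mono[OF card_region_even_le])
  then have Ev: "real (card (region m \<inter> even_verts)) \<le> (real m)\<^sup>2 + (2 * m + 1)"
    by (simp add: power2_eq_square algebra_simps)
  have p: "p * (3 * m + 1) \<le> 3 * m + 1" "p\<^sup>2 * m \<le> m"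
    using assms by (auto intro!: mult_left_le_one_le simp: power_le_one)
  have "p * (2 - p) \<le> 1"
    using zero_le_power2[of "p - 1"] by (simp add: power2_eq_square algebra_simps)
  then have "p ^ 4 * (p * (2 - p)) \<le> 1 * 1"
    using assms by (intro mult_mono power_le_one) auto
  then have h: "p ^ 5 * (2 - p) \<le> 1" "0 \<le> p ^ 5 * (2 - p)"
    using assms by (simp_all add: eval_nat_numeral mult.assoc)
  have h': "p ^ 5 * (2 - p) * (2 * m + 1) \<le> 2 * m + 1"
    using h by (intro mult_left_le_one_le) auto
  have "mean_clusters (region m) p \<le> p * card (region m) - p\<^sup>2 * card (brick (region m))
      + p ^ 5 * (2 - p) * card (region m \<inter> even_verts)"
    by (rule mean_clusters_upper[OF finite_region assms])
  also have "\<dots> \<le> p * (2 * (real m)\<^sup>2 + (3 * m + 1)) - p\<^sup>2 * (3 * (real m)\<^sup>2 - m)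
      + p ^ 5 * (2 - p) * ((real m)\<^sup>2 + (2 * m + 1))"
    using assms h by (intro add_mono diff_mono mult_left_mono N B Ev) auto
  also have "\<dots> = 2 * (real m)\<^sup>2 * (p - 3 / 2 * p\<^sup>2 + p ^ 5 * (2 - p) / 2)
      + (p * (3 * m + 1) + p\<^sup>2 * m + p ^ 5 * (2 - p) * (2 * m + 1))"
    by (simp add: field_simps)
  also have "\<dots> \<le> 2 * (real m)\<^sup>2 * (p - 3 / 2 * p\<^sup>2 + p ^ 5 * (2 - p) / 2) + 6 * m + 2"
    using p h' by linarith
  finally show ?thesis .
qed

text \<open>The constant 5 = 1 + 4 covers the smallest \<open>m\<close>, where the squares
  \<open>(real m - 1)\<^sup>2\<close> and \<open>(real m - 2)\<^sup>2\<close> can be positive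
  although no hexagon or ring is counted.\<close>

lemma mean_clusters_region_lower:
  fixes p :: real
  assumes "0 \<le> p" "p \<le> 1"
  shows "p * (2 * (real m)\<^sup>2) - p\<^sup>2 * ((real m + 1) * (3 * real m + 2)) + p ^ 6 * (real m - 1)\<^sup>2
    + p ^ 12 * (1 - p) * (real m - 2)\<^sup>2 - 5 \<le> mean_clusters (region m) p"
proof -
  let ?f = "\<lambda>(c, k). (c, 2 * k + c mod 2) :: vertex"
  have inj: "inj_on ?f A" for A by (auto simp: inj_on_def)
  have even: "?f v \<in> even_verts" for v
    by (cases v) (simp add: even_verts_def)
  \<comment> \<open>The margins keep hexagons and rings inside the region and off its last
    line.\<close>
  let ?P = "{0..int m - 2} \<times> {0..int m - 2}" and ?Q = "{0..int m - 3} \<times> {1..int m - 2}"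
  have modc: "(c :: int) mod 2 = 0 \<or> c mod 2 = 1" for c by presburger
  have H: "hexagon v \<subseteq> region m" if "v \<in> ?f ` ?P" for v
  proof -
    obtain c k where v: "v = (c, 2 * k + c mod 2)" "0 \<le> c" "c \<le> int m - 2" "0 \<le> k" "k \<le> int m - 2"
      using \<open>v \<in> ?f ` ?P\<close> by auto
    show ?thesis using v modc[of c] unfolding hexagon_def by (auto simp: region_iff)
  qed
  have R: "insert (ring_centre v) (ring v) \<subseteq> region m" if "v \<in> ?f ` ?Q" for v
  proof -
    obtain c k where v: "v = (c, 2 * k + c mod 2)" "0 \<le> c" "c \<le> int m - 3" "1 \<le> k" "k \<le> int m - 2"
      using \<open>v \<in> ?f ` ?Q\<close> by auto
    show ?thesis using v modc[of c] unfolding ring_def ring_centre_def by (auto simp: region_iff)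
  qed
  have cH: "real (card (?f ` ?P)) \<ge> (real m - 1)\<^sup>2 - 1"
    by (cases m) (simp_all add: card_image[OF inj] card_cartesian_product power2_eq_square)
  have cR: "real (card (?f ` ?Q)) \<ge> (real m - 2)\<^sup>2 - 4"
  proof (cases "m \<ge> 2")
    case True
    then have "card (?f ` ?Q) = (m - 2)\<^sup>2"
      by (simp add: card_image[OF inj] card_cartesian_product power2_eq_square nat_diff_distrib')
    then show ?thesis using True by (simp add: of_nat_diff)
  next
    case False
    then have "m = 0 \<or> m = 1" by auto
    then show ?thesis by auto
  qed
  have "real (card (brick (region m))) \<le> real ((m + 1) * (3 * m + 2))"
    by (rule of_nat_mono[OF card_brick_region_le])
  then have B: "real (card (brick (region m))) \<le> (real m + 1) * (3 * real m + 2)"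
    by (simp add: algebra_simps)
  have "real (2 * m\<^sup>2) \<le> real (card (region m))" by (rule of_nat_mono[OF card_region_ge])
  then have N: "2 * (real m)\<^sup>2 \<le> real (card (region m))" by simp
  have q: "p ^ 6 \<le> 1" "p ^ 12 * (1 - p) \<le> 1" "0 \<le> p ^ 12 * (1 - p)"
    using assms by (auto intro!: mult_le_one power_le_one)
  have "p * (2 * (real m)\<^sup>2) - p\<^sup>2 * ((real m + 1) * (3 * real m + 2)) + p ^ 6 * (real m - 1)\<^sup>2
      + p ^ 12 * (1 - p) * (real m - 2)\<^sup>2 - 5
    \<le> p * (2 * (real m)\<^sup>2) - p\<^sup>2 * ((real m + 1) * (3 * real m + 2)) + p ^ 6 * ((real m - 1)\<^sup>2 - 1)
      + p ^ 12 * (1 - p) * ((real m - 2)\<^sup>2 - 4)"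
    using q by (simp add: right_diff_distrib)
  also have "\<dots> \<le> p * card (region m) - p\<^sup>2 * card (brick (region m)) + p ^ 6 * card (?f ` ?P)
      + p ^ 12 * (1 - p) * card (?f ` ?Q)"
    using assms q by (intro add_mono diff_mono mult_left_mono N B cH cR) auto
  also have "\<dots> \<le> mean_clusters (region m) p"
    using even H R by (intro mean_clusters_lower[OF finite_region assms]) auto
  finally show ?thesis .
qed

text \<open>The maximum is attained near \<open>p = 0.354\<close>; the polynomial \<open>h\<close> is the quotient of the
  difference of the two sides by \<open>(p - 0.354)\<^sup>2\<close>.\<close>

lemma polynomial_bound:
  fixes p :: real
  assumes "0 \<le> p" "p \<le> 1"
  shows "p - 3 / 2 * p\<^sup>2 + p ^ 5 * (2 - p) / 2 \<le> 0.1714"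
proof -
  define h where "h = 1 / 2 * p ^ 4 - 0.646 * p ^ 3 - 0.520026 * p\<^sup>2 - 0.287224272 * p + 1.36181279364"
  \<comment> \<open>Subtracting these two nonnegative polynomials from \<open>h\<close> removes its
    quartic and cubic terms; by \<open>p\<^sup>2 \<le> p\<close> what remains is at least 1.36 -
    0.96 p.\<close>
  have "0 \<le> p\<^sup>2 * (p - 1)\<^sup>2 / 2" by simp
  moreover have "0 \<le> 0.354 * (p * (p - 1)\<^sup>2)" using assms by simp
  moreover have "p\<^sup>2 \<le> p" using assms by (simp add: power2_eq_square mult_left_le)
  ultimately have "0 \<le> h" using assms
    unfolding h_def by (simp add: power2_eq_square power3_eq_cube power4_eq_xxxx algebra_simps)
  \<comment> \<open>As 0.354 is only close to the maximiser and 0.1714 only close to the maximum,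
    the division leaves a small linear remainder; both its coefficients are positive.\<close>
  then have "0 \<le> (p - 0.354)\<^sup>2 * h + 0.000157254767072 * p + 0.00074306795220976"
    using assms by (intro add_nonneg_nonneg mult_nonneg_nonneg) auto
  also have "\<dots> = 0.1714 - (p - 3 / 2 * p\<^sup>2 + p ^ 5 * (2 - p) / 2)"
    unfolding h_def by (simp add: eval_nat_numeral field_simps)
  finally show ?thesis by (simp only: diff_ge_0_iff_ge)
qed

section \<open>Existence of the limit\<close>

text \<open>Up to a few boundary vertices, the region of parameter \<open>n\<close> is tiled by translates of the
  region of parameter \<open>m\<close>; the horizontal period has to be even.\<close>

definition period :: "nat \<Rightarrow> nat" where
  "period m = 2 * (m div 2) + 2"

lemma period_bounds: "m < period m" "period m \<le> m + 2" "even (period m)"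
  unfolding period_def by auto

text \<open>A tile spans m + 1 lines and 2m + 1 rows, so the periods \<open>period m\<close> and
  \<open>2 * period m\<close> keep tiles disjoint. Each vertex outside the tiles adds at most one
  cluster, which gives the second summand.\<close>

lemma mean_clusters_region_subadditive:
  fixes p :: real
  assumes "0 \<le> p" "p \<le> 1"
  defines "k \<equiv> \<lambda>m n. n div period m"
  shows "mean_clusters (region n) p \<le> (real (k m n))\<^sup>2 * mean_clusters (region m) p
    + (card (region n) - (real (k m n))\<^sup>2 * card (region m))"
proof -
  let ?h = "period m" and ?I = "{..<k m n} \<times> {..<k m n}"
  define T where "T = (\<lambda>(s, t). shift (int s * int ?h) (2 * (int t * int ?h)) ` region m)"
  let ?U = "\<Union>i\<in>?I. T i"
  have fin: "finite (T i)" for i by (simp add: T_def finite_region split: prod.splits)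
  have T: "mean_clusters (T i) p = mean_clusters (region m) p" "card (T i) = card (region m)" for i
    unfolding T_def using period_bounds(3)[of m]
    by (auto simp: mean_clusters_shift card_image[OF inj_on_subset[OF inj_shift subset_UNIV]]
        split: prod.splits)
  have T_bounds: "int s * int ?h \<le> c" "c \<le> int s * int ?h + int m"
    "2 * (int t * int ?h) - 1 \<le> y" "y \<le> 2 * (int t * int ?h) + 2 * int m - 1"
    if "(c, y) \<in> T (s, t)" for s t c y
    using that unfolding T_def by (auto simp: shift_def region_iff)
  have h: "int m < int ?h" using period_bounds(1)[of m] by simp
  \<comment> \<open>The index of a tile is recovered from any of its vertices by division;
    \<open>y + 1\<close> is used because rows start at -1.\<close>
  have tile: "c div int ?h = int s \<and> (y + 1) div (2 * int ?h) = int t" if "(c, y) \<in> T (s, t)" for s t c y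
  proof
    note b = T_bounds[OF that]
    have "c = int ?h * int s + (c - int ?h * int s)" by simp
    then show "c div int ?h = int s"
      by (rule int_div_pos_eq) (use b h in \<open>auto simp: mult.commute mult.left_commute\<close>)
    have "y + 1 = 2 * int ?h * int t + (y + 1 - 2 * int ?h * int t)" by simp
    then show "(y + 1) div (2 * int ?h) = int t"
      by (rule int_div_pos_eq) (use b h in \<open>auto simp: mult.commute mult.left_commute\<close>)
  qed
  have disj: "T i \<inter> T j = {}" if "i \<noteq> j" for i j
  proof (rule ccontr)
    assume "T i \<inter> T j \<noteq> {}"
    then obtain v where "v \<in> T i" "v \<in> T j" by blast
    then have "int (fst i) = int (fst j) \<and> int (snd i) = int (snd j)"
      using tile[of "fst v" "snd v" "fst i" "snd i"] tile[of "fst v" "snd v" "fst j" "snd j"] by simp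
    then show False using that by (simp add: prod_eq_iff)
  qed
  have end_le: "int s * int ?h + int ?h \<le> int n" if "s < k m n" for s
  proof -
    have "Suc s * ?h \<le> (n div ?h) * ?h" using that unfolding k_def by (intro mult_right_mono) auto
    also have "\<dots> \<le> n" by simp
    finally have "int (Suc s * ?h) \<le> int n" by linarith
    then show ?thesis by (simp add: algebra_simps)
  qed
  have sub: "T i \<subseteq> region n" if "i \<in> ?I" for i
  proof
    fix v assume v: "v \<in> T i"
    obtain s t c y where it: "i = (s, t)" "v = (c, y)" by fastforce
    have "(c, y) \<in> T (s, t)" "s < k m n" "t < k m n" using v that unfolding it by auto
    note b = T_bounds[OF this(1)] end_le[OF this(2)] end_le[OF this(3)] h
    have "0 \<le> int s * int ?h" "0 \<le> int t * int ?h" by auto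
    \<comment> \<open>The strict bound on \<open>c\<close> keeps the tiles off the last line, where
      vertices may be missing.\<close>
    then have "0 \<le> c" "c < int n" "-1 \<le> y" "y \<le> 2 * int n - 1" using b by linarith+
    then show "v \<in> region n" unfolding it region_iff by auto
  qed
  have cU: "card ?U = (k m n)\<^sup>2 * card (region m)"
    using disj fin by (subst card_UN_disjoint) (auto simp: T card_cartesian_product power2_eq_square)
  have finU: "finite ?U" using fin by auto
  have subU: "?U \<subseteq> region n" using sub by blast
  then have "?U \<union> (region n - ?U) = region n" by blast
  then have "mean_clusters (region n) p \<le> mean_clusters ?U p + mean_clusters (region n - ?U) p"
    using mean_clusters_Un[of ?U "region n - ?U" p] finU finite_region[of n] assms by simp
  also have "mean_clusters ?U p \<le> (\<Sum>i\<in>?I. mean_clusters (T i) p)"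
    using fin assms by (intro mean_clusters_UN) auto
  also have "\<dots> = (real (k m n))\<^sup>2 * mean_clusters (region m) p"
    by (simp add: T card_cartesian_product power2_eq_square)
  also have "mean_clusters (region n - ?U) p \<le> card (region n - ?U)"
    using finite_region assms by (intro mean_clusters_le_card) auto
  also have "card (region n - ?U) = card (region n) - card ?U"
    by (rule card_Diff_subset[OF finU subU])
  also have "real \<dots> = card (region n) - (real (k m n))\<^sup>2 * card (region m)"
    using card_mono[OF finite_region subU] by (simp add: of_nat_diff cU)
  finally show ?thesis by simp
qed

section \<open>The supremum over p\<close>

definition max_mean :: "nat \<Rightarrow> real" where
  "max_mean m = (SUP p\<in>{0<..<1}. mean_clusters (region m) p)"

lemma max_mean_least:
  assumes "\<And>p. 0 < p \<Longrightarrow> p < 1 \<Longrightarrow> mean_clusters (region m) p \<le> c"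
  shows "max_mean m \<le> c"
  unfolding max_mean_def using assms by (intro cSUP_least) auto

lemma max_mean_upper:
  assumes "0 < p" "p < 1"
  shows "mean_clusters (region m) p \<le> max_mean m"
  unfolding max_mean_def
proof (rule cSUP_upper)
  show "bdd_above ((\<lambda>p. mean_clusters (region m) p) ` {0<..<1})"
    by (intro bdd_aboveI2[of _ _ "real (card (region m))"] mean_clusters_le_card finite_region) auto
qed (use assms in simp)

lemma max_mean_le_card: "max_mean m \<le> card (region m)"
  by (intro max_mean_least mean_clusters_le_card finite_region) auto

lemma max_mean_nonneg: "0 \<le> max_mean m"
proof -
  have "0 \<le> mean_clusters (region m) (1 / 2)"
    unfolding mean_clusters_def mean_def weight_def by (intro sum_nonneg) auto
  also have "\<dots> \<le> max_mean m" by (rule max_mean_upper) auto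
  finally show ?thesis .
qed

lemma max_mean_subadditive:
  "max_mean n \<le> (real (n div period m))\<^sup>2 * max_mean m
    + (card (region n) - (real (n div period m))\<^sup>2 * card (region m))"
proof (rule max_mean_least)
  fix p :: real assume p: "0 < p" "p < 1"
  then show "mean_clusters (region n) p \<le> (real (n div period m))\<^sup>2 * max_mean m
    + (card (region n) - (real (n div period m))\<^sup>2 * card (region m))"
    using mean_clusters_region_subadditive[of p n m]
      mult_left_mono[OF max_mean_upper[OF p, of m], of "(real (n div period m))\<^sup>2"] by simp
qed

section \<open>Asymptotic densities of vertices and tiles\<close>

lemma region_density: "(\<lambda>m. card (region m) / (real m)\<^sup>2) \<longlonglongrightarrow> 2"
proof (rule tendsto_sandwich)
  show "\<forall>\<^sub>F m in sequentially. 2 \<le> card (region m) / (real m)\<^sup>2"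
    using eventually_gt_at_top[of 0]
  proof eventually_elim
    case (elim m)
    have "real (2 * m\<^sup>2) \<le> real (card (region m))" by (rule of_nat_mono[OF card_region_ge])
    then show ?case using elim by (simp add: field_simps)
  qed
  show "\<forall>\<^sub>F m in sequentially. card (region m) / (real m)\<^sup>2 \<le> real ((m + 1) * (2 * m + 1)) / (real m)\<^sup>2"
    by (intro always_eventually allI divide_right_mono of_nat_mono card_region_le) auto
  show "(\<lambda>m. real ((m + 1) * (2 * m + 1)) / (real m)\<^sup>2) \<longlonglongrightarrow> 2"
    unfolding of_nat_mult of_nat_add of_nat_1 of_nat_numeral by real_asymp
qed simp

lemma card_region_pos: "m > 0 \<Longrightarrow> card (region m) > 0"
  using card_region_ge[of m] by (auto intro: Nat.gr0I)

lemma tile_density: "(\<lambda>n. (real (n div h))\<^sup>2 / card (region n)) \<longlonglongrightarrow> 1 / (2 * (real h)\<^sup>2)"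
  if "h > 0"
proof -
  have "(\<lambda>n. real (n div h) / real n) \<longlonglongrightarrow> 1 / h"
  proof (rule tendsto_sandwich)
    show "\<forall>\<^sub>F n in sequentially. 1 / h - 1 / real n \<le> real (n div h) / real n"
      using eventually_gt_at_top[of 0]
    proof eventually_elim
      case (elim n)
      have "n \<le> n div h * h + h" using mod_less_divisor[OF that, of n] div_mult_mod_eq[of n h] by linarith
      then have "real n \<le> real (n div h * h + h)" by (rule of_nat_mono)
      then have "real n / h - 1 \<le> real (n div h)" using that by (simp add: field_simps)
      then have "(real n / h - 1) / real n \<le> real (n div h) / real n" by (rule divide_right_mono) simp
      then show ?case using elim by (simp add: diff_divide_distrib)
    qed
    show "\<forall>\<^sub>F n in sequentially. real (n div h) / real n \<le> 1 / h"
      using eventually_gt_at_top[of 0]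
    proof eventually_elim
      case (elim n)
      have "real (n div h * h) \<le> real n" by (intro of_nat_mono) simp
      then show ?case using elim that by (simp add: field_simps)
    qed
    show "(\<lambda>n. 1 / real h - 1 / real n) \<longlonglongrightarrow> 1 / real h" by real_asymp
  qed simp
  then have "(\<lambda>n. (real (n div h) / real n)\<^sup>2 / (card (region n) / (real n)\<^sup>2)) \<longlonglongrightarrow> (1 / h)\<^sup>2 / 2"
    by (intro tendsto_divide[OF tendsto_power region_density]) auto
  also have "(1 / real h)\<^sup>2 / 2 = 1 / (2 * (real h)\<^sup>2)" by (simp add: power_divide)
  finally show ?thesis
  proof (rule Lim_transform_eventually)
    show "\<forall>\<^sub>F n in sequentially. (real (n div h) / real n)\<^sup>2 / (card (region n) / (real n)\<^sup>2)
        = (real (n div h))\<^sup>2 / card (region n)"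
      using eventually_gt_at_top[of 0] by eventually_elim (simp add: power_divide)
  qed
qed

text \<open>A period cell contains \<open>2 * (real (period m))\<^sup>2\<close> vertices of the
  wall, so large tiles waste only a vanishing share of them.\<close>

lemma period_density: "(\<lambda>m. card (region m) / (2 * (real (period m))\<^sup>2)) \<longlonglongrightarrow> 1"
proof -
  have "(\<lambda>m. real (period m) / real m) \<longlonglongrightarrow> 1"
  proof (rule tendsto_sandwich)
    show "\<forall>\<^sub>F m in sequentially. 1 \<le> real (period m) / real m"
      using eventually_gt_at_top[of 0]
      by eventually_elim (use period_bounds(1) in \<open>simp add: le_divide_eq less_imp_le\<close>)
    show "\<forall>\<^sub>F m in sequentially. real (period m) / real m \<le> (real m + 2) / real m"
    proof (intro always_eventually allI divide_right_mono)
      show "real (period m) \<le> real m + 2" for m using period_bounds(2)[of m] by linarith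
    qed simp
    show "(\<lambda>m. (real m + 2) / real m) \<longlonglongrightarrow> 1" by real_asymp
  qed simp
  then have "(\<lambda>m. card (region m) / (real m)\<^sup>2 / (2 * (real (period m) / real m)\<^sup>2)) \<longlonglongrightarrow> 2 / (2 * 1\<^sup>2)"
    by (intro tendsto_divide tendsto_mult tendsto_power tendsto_const region_density) auto
  also have "(2 :: real) / (2 * 1\<^sup>2) = 1" by simp
  finally show ?thesis
  proof (rule Lim_transform_eventually)
    show "\<forall>\<^sub>F m in sequentially. card (region m) / (real m)\<^sup>2 / (2 * (real (period m) / real m)\<^sup>2)
        = card (region m) / (2 * (real (period m))\<^sup>2)"
      using eventually_gt_at_top[of 0] by eventually_elim (simp add: power_divide)
  qed
qed

text \<open>A form of Fekete's argument: every \<open>g m\<close> bounds the upper limit of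
  \<open>b\<close>, while \<open>b n\<close> is eventually close to \<open>g n\<close>, which is
  never below the infimum.\<close>

lemma convergent_if_almost_upper_bounds:
  fixes b g :: "nat \<Rightarrow> real"
  assumes nonneg: "\<And>n. 0 \<le> b n"
    and upper: "\<And>m e. 0 < e \<Longrightarrow> \<forall>\<^sub>F n in sequentially. b n \<le> g m + e"
    and gap: "(\<lambda>m. g m - b m) \<longlonglongrightarrow> 0"
  shows "b \<longlonglongrightarrow> (INF m. g m)"
proof (rule tendstoI)
  fix e :: real assume e: "0 < e"
  have "bdd_below (range g)"
  proof (rule bdd_belowI2)
    fix m
    obtain n where "b n \<le> g m + 1" using eventually_happens[OF upper[of 1 m]] by auto
    then show "- 1 \<le> g m" using nonneg[of n] by linarith
  qed
  then have low: "(INF m. g m) \<le> g m" for m by (intro cINF_lower) auto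
  obtain m where m: "g m < (INF m. g m) + e / 2"
  proof (rule ccontr)
    assume "\<not> thesis"
    then have "(INF m. g m) + e / 2 \<le> g m" for m using that by (meson not_le)
    then have "(INF m. g m) + e / 2 \<le> (INF m. g m)" by (intro cINF_greatest) auto
    then show False using e by simp
  qed
  have "\<forall>\<^sub>F n in sequentially. b n \<le> g m + e / 2" using e by (intro upper) simp
  moreover have "\<forall>\<^sub>F n in sequentially. g n - b n < e" using order_tendstoD(2)[OF gap e] .
  ultimately show "\<forall>\<^sub>F n in sequentially. dist (b n) (INF m. g m) < e"
  proof eventually_elim
    case (elim n)
    then show ?case using m low[of n] by (simp add: dist_real_def abs_less_iff)
  qed
qed

lemma max_mean_density_converges: "\<exists>L. (\<lambda>m. max_mean m / card (region m)) \<longlonglongrightarrow> L"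
proof -
  let ?N = "\<lambda>m. real (card (region m))"
  let ?b = "\<lambda>m. max_mean m / ?N m"
  \<comment> \<open>The limit, as n tends to infinity, of the tiling bound with tiles of parameter
    \<open>m\<close>.\<close>
  define g where "g m = 1 - 1 / (2 * (real (period m))\<^sup>2) * (?N m - max_mean m)" for m
  have upper: "\<forall>\<^sub>F n in sequentially. ?b n \<le> g m + e" if "0 < e" for m e
  proof -
    let ?q = "\<lambda>n. (real (n div period m))\<^sup>2 / ?N n"
    have "(\<lambda>n. 1 - ?q n * (?N m - max_mean m)) \<longlonglongrightarrow> g m"
      unfolding g_def by (intro tendsto_intros tile_density) (simp add: period_def)
    then have "\<forall>\<^sub>F n in sequentially. 1 - ?q n * (?N m - max_mean m) < g m + e"
      by (rule order_tendstoD) (use that in simp)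
    then show ?thesis using eventually_gt_at_top[of 0]
    proof eventually_elim
      case (elim n)
      have "?b n \<le> ((real (n div period m))\<^sup>2 * max_mean m
          + (?N n - (real (n div period m))\<^sup>2 * ?N m)) / ?N n"
        by (intro divide_right_mono max_mean_subadditive) simp
      also have "\<dots> = 1 - ?q n * (?N m - max_mean m)"
        using card_region_pos[OF elim(2)] by (simp add: field_simps)
      finally show ?case using elim by linarith
    qed
  qed
  have b: "0 \<le> ?b m" "?b m \<le> 1" for m
    using max_mean_nonneg[of m] max_mean_le_card[of m] by (auto simp: divide_le_eq_1)
  have "(\<lambda>m. g m - ?b m) \<longlonglongrightarrow> 0"
  proof (rule Lim_null_comparison)
    let ?r = "\<lambda>m. ?N m / (2 * (real (period m))\<^sup>2)"
    show "(\<lambda>m. \<bar>1 - ?r m\<bar>) \<longlonglongrightarrow> 0"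
      using tendsto_rabs[OF tendsto_diff[OF tendsto_const period_density, of 1]] by simp
    show "\<forall>\<^sub>F m in sequentially. norm (g m - ?b m) \<le> \<bar>1 - ?r m\<bar>"
      using eventually_gt_at_top[of 0]
    proof eventually_elim
      case (elim m)
      \<comment> \<open>The gap is the share of vertices outside the tiles, times a factor between 0
        and 1.\<close>
      have "g m - ?b m = (1 - ?r m) * (1 - ?b m)"
        using card_region_pos[OF elim] unfolding g_def by (simp add: algebra_simps)
      then show ?case using b[of m] by (simp add: abs_mult mult_left_le)
    qed
  qed
  then have "?b \<longlonglongrightarrow> (INF m. g m)"
    by (intro convergent_if_almost_upper_bounds upper b)
  then show ?thesis by blast
qed

section \<open>Numerical bounds for the limit\<close>

theorem theorem4:
  "\<exists>L::real.
     (\<lambda>m::nat. (SUP p\<in>{0<..<1::real}. expected_components (hex_verts m) (hex_edges m) p)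
                 / real (card (hex_verts m))) \<longlonglongrightarrow> L
     \<and> L \<in> {0.16738<..<0.17144}"
proof -
  obtain L where L: "(\<lambda>m. max_mean m / card (region m)) \<longlonglongrightarrow> L"
    using max_mean_density_converges by blast
  have "(\<lambda>m. max_mean m / card (region m) * (card (region m) / (real m)\<^sup>2)) \<longlonglongrightarrow> L * 2"
    by (intro tendsto_mult L region_density)
  then have L2: "(\<lambda>m. max_mean m / (real m)\<^sup>2) \<longlonglongrightarrow> L * 2"
  proof (rule Lim_transform_eventually)
    show "\<forall>\<^sub>F m in sequentially. max_mean m / card (region m) * (card (region m) / (real m)\<^sup>2)
        = max_mean m / (real m)\<^sup>2"
      using eventually_gt_at_top[of 0] by eventually_elim (use card_region_pos in force)
  qed
  have "L * 2 \<le> 2 * 0.1714"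
  proof (rule LIMSEQ_le[OF L2])
    show "(\<lambda>m. 2 * 0.1714 + (6 * real m + 2) / (real m)\<^sup>2) \<longlonglongrightarrow> 2 * 0.1714" by real_asymp
    have "max_mean m / (real m)\<^sup>2 \<le> 2 * 0.1714 + (6 * real m + 2) / (real m)\<^sup>2" if "m \<ge> 1" for m
    proof -
      have "max_mean m \<le> 2 * (real m)\<^sup>2 * 0.1714 + (6 * real m + 2)"
      proof (rule max_mean_least)
        fix p :: real assume "0 < p" "p < 1"
        then show "mean_clusters (region m) p \<le> 2 * (real m)\<^sup>2 * 0.1714 + (6 * real m + 2)"
          using mean_clusters_region_upper[of p m]
            mult_left_mono[OF polynomial_bound[of p], of "2 * (real m)\<^sup>2"] by simp
      qed
      then show ?thesis using that by (simp add: field_simps)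
    qed
    then show "\<exists>N. \<forall>m\<ge>N. max_mean m / (real m)\<^sup>2 \<le> 2 * 0.1714 + (6 * real m + 2) / (real m)\<^sup>2"
      by blast
  qed
  \<comment> \<open>A fixed \<open>p\<close> already bounds the supremum from below, so the limit in
    m is taken at that \<open>p\<close> alone.\<close>
  moreover have "2 * p - 3 * p\<^sup>2 + p ^ 6 + p ^ 12 * (1 - p) \<le> L * 2" if p: "0 < p" "p < 1" for p :: real
  proof (rule LIMSEQ_le[OF _ L2])
    have "(\<lambda>m. (real m + 1) * (3 * real m + 2) / (real m)\<^sup>2) \<longlonglongrightarrow> 3"
      "(\<lambda>m. (real m - 1)\<^sup>2 / (real m)\<^sup>2) \<longlonglongrightarrow> 1"
      "(\<lambda>m. (real m - 2)\<^sup>2 / (real m)\<^sup>2) \<longlonglongrightarrow> 1"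
      "(\<lambda>m. 5 / (real m)\<^sup>2) \<longlonglongrightarrow> 0" by real_asymp+
    then have "(\<lambda>m. 2 * p - p\<^sup>2 * ((real m + 1) * (3 * real m + 2) / (real m)\<^sup>2)
        + p ^ 6 * ((real m - 1)\<^sup>2 / (real m)\<^sup>2)
        + p ^ 12 * (1 - p) * ((real m - 2)\<^sup>2 / (real m)\<^sup>2) - 5 / (real m)\<^sup>2)
      \<longlonglongrightarrow> 2 * p - p\<^sup>2 * 3 + p ^ 6 * 1 + p ^ 12 * (1 - p) * 1 - 0"
      by (intro tendsto_intros)
    then show "(\<lambda>m. 2 * p - p\<^sup>2 * ((real m + 1) * (3 * real m + 2) / (real m)\<^sup>2)
        + p ^ 6 * ((real m - 1)\<^sup>2 / (real m)\<^sup>2)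
        + p ^ 12 * (1 - p) * ((real m - 2)\<^sup>2 / (real m)\<^sup>2) - 5 / (real m)\<^sup>2)
      \<longlonglongrightarrow> 2 * p - 3 * p\<^sup>2 + p ^ 6 + p ^ 12 * (1 - p)" by (rule tendsto_eq_rhs) simp
    have "2 * p - p\<^sup>2 * ((real m + 1) * (3 * real m + 2) / (real m)\<^sup>2)
        + p ^ 6 * ((real m - 1)\<^sup>2 / (real m)\<^sup>2)
        + p ^ 12 * (1 - p) * ((real m - 2)\<^sup>2 / (real m)\<^sup>2) - 5 / (real m)\<^sup>2
      \<le> max_mean m / (real m)\<^sup>2" if "m \<ge> 1" for m
    proof -
      have "(p * (2 * (real m)\<^sup>2) - p\<^sup>2 * ((real m + 1) * (3 * real m + 2)) + p ^ 6 * (real m - 1)\<^sup>2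
          + p ^ 12 * (1 - p) * (real m - 2)\<^sup>2 - 5) / (real m)\<^sup>2 \<le> max_mean m / (real m)\<^sup>2"
        using mean_clusters_region_lower[of p m] max_mean_upper[of p m] p
        by (intro divide_right_mono) auto
      moreover have "p * (2 * (real m)\<^sup>2) / (real m)\<^sup>2 = 2 * p" using that by simp
      ultimately show ?thesis by (simp add: add_divide_distrib diff_divide_distrib)
    qed
    then show "\<exists>N. \<forall>m\<ge>N. 2 * p - p\<^sup>2 * ((real m + 1) * (3 * real m + 2) / (real m)\<^sup>2)
        + p ^ 6 * ((real m - 1)\<^sup>2 / (real m)\<^sup>2)
        + p ^ 12 * (1 - p) * ((real m - 2)\<^sup>2 / (real m)\<^sup>2) - 5 / (real m)\<^sup>2
      \<le> max_mean m / (real m)\<^sup>2" by blast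
  qed
  \<comment> \<open>The hexagons alone give at most \<open>0.1673797\<close>; the rings are needed to pass \<open>0.16738\<close>.\<close>
  from this[of "0.338"] have "0.16738 * 2 < L * 2" by (simp add: eval_nat_numeral)
  ultimately have "L \<in> {0.16738<..<0.17144}" by simp
  moreover have "(\<lambda>m. (SUP p\<in>{0<..<1::real}. expected_components (hex_verts m) (hex_edges m) p)
                 / real (card (hex_verts m))) \<longlonglongrightarrow> L"
  proof (rule Lim_transform_eventually[OF L])
    show "\<forall>\<^sub>F m in sequentially. max_mean m / card (region m) =
      (SUP p\<in>{0<..<1::real}. expected_components (hex_verts m) (hex_edges m) p) / real (card (hex_verts m))"
      using eventually_ge_at_top[of 1]
    proof eventually_elim
      case (elim m)
      have "(SUP p\<in>{0<..<1::real}. expected_components (hex_verts m) (hex_edges m) p) = max_mean m"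
        unfolding max_mean_def using elim by (intro SUP_cong) (auto simp: expected_components_hex)
      then show ?case using elim by (simp add: card_hex_verts)
    qed
  qed
  ultimately show ?thesis by blast
qed

end
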